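(* Let $G$ be a group, $H$ a hyperbolically embedded subgroup of $G$, $V$ a normed $G$-module, and $U$ an $H$-submodule of $V$. Then there exists an $\mathbb F$-linear map $\kappa\colon QZ^1(H,U)\to QZ^1(G,V)$ such that for every $q\in QZ^1(H,U)$ we have $\kappa(q)|_H\in QZ^1(H,U)$ and $$\sup_{h\in H}\|\kappa(q)(h)-q(h)\|<\infty .$$
   Context: $\mathbb F$ is a subfield of $\mathbb C$; all modules are left, all vector spaces are over $\mathbb F$. For a discrete group $G$, a normed $G$-module is a normed vector space $V$ with a left action of $G$ by (linear) isometries. For a subgroup $H\le G$, an $H$-submodule of $V$ is an $H$-invariant subspace of $V$ with the induced action and norm. A map $q\colon G\to V$ is a (1-)quasi-cocycle if there is $\varepsilon>0$ with $\|q(fg)-q(f)-fq(g)\|\le\varepsilon$ for all $f,g\in G$. $QZ^1(G,V)$ is the $\mathbb F$-vector space of all quasi-cocycles $G\to V$. Hyperbolically embedded subgroups: let $H\le G$ and $X\subseteq G$ with $G=\langle X\cup H\rangle$. Let $\Gamma(G,X\sqcup (H\setminus\{1\}))$ be the Cayley graph of $G$ with edges labeled by letters of the disjoint union $X\sqcup (H\setminus\{1\})$ (letters representing the same element give multiple edges). The complete graph $\Gamma(H,H\setminus\{1\})$ is viewed as a subgraph. For $h,k\in H$ let $\widehat d(h,k)\in[0,+\infty]$ be the length of a shortest path in $\Gamma(G,X\sqcup (H\setminus\{1\}))$ from $h$ to $k$ having no edges in $\Gamma(H,H\setminus\{1\})$ ($=\infty$ if none exists). $H$ is hyperbolically embedded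 in $G$ with respect to $X$ if (a) $G=\langle X\cup H\rangle$ and $\Gamma(G,X\sqcup (H\setminus\{1\}))$ is Gromov hyperbolic, and (b) $(H,\widehat d)$ is locally finite, i.e. every ball of finite radius contains finitely many elements. $H$ is hyperbolically embedded in $G$ if this holds for some (not necessarily finite) $X\subseteq G$. *)

theory Defs
  imports
    Complex_Main
    "HOL-Library.FuncSet"
    "HOL-Library.Extended_Nat"
    "HOL-Algebra.Group_Action"
    "HOL-Algebra.Generated_Groups"
    "Graph_Theory.Arc_Walk"
begin

section \<open>Normed modules over a subfield of the complex numbers\<close>

text \<open>
  A subfield of the complex numbers is a field type \<open>'f\<close> together with a (necessarily injective)
  unital ring homomorphism \<open>\<iota>\<close> into \<^typ>\<open>complex\<close>; the absolute value of a scalar \<open>a\<close> is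
  \<open>cmod (\<iota> a)\<close>.
\<close>

locale complex_subfield =
  fixes \<iota> :: "'f::field \<Rightarrow> complex"
  assumes emb_add: "\<iota> (a + b) = \<iota> a + \<iota> b"
    and emb_mult: "\<iota> (a * b) = \<iota> a * \<iota> b"
    and emb_one: "\<iota> 1 = 1"

locale normed_space_over = complex_subfield \<iota> + vector_space scale
  for \<iota> :: "'f::field \<Rightarrow> complex" and scale :: "'f \<Rightarrow> 'v::ab_group_add \<Rightarrow> 'v" +
  fixes nrm :: "'v \<Rightarrow> real"
  assumes nrm_nonneg: "0 \<le> nrm v"
    and nrm_eq_0: "nrm v = 0 \<longleftrightarrow> v = 0"
    and nrm_scale: "nrm (scale a v) = cmod (\<iota> a) * nrm v"
    and nrm_triangle: "nrm (v + w) \<le> nrm v + nrm w"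

locale normed_group_module =
  normed_space_over \<iota> scale nrm + group_action G UNIV act
  for G :: "('g, 'b) monoid_scheme" (structure)
    and \<iota> :: "'f::field \<Rightarrow> complex" and scale :: "'f \<Rightarrow> 'v::ab_group_add \<Rightarrow> 'v"
    and nrm :: "'v \<Rightarrow> real" and act :: "'g \<Rightarrow> 'v \<Rightarrow> 'v" +
  assumes act_linear: "g \<in> carrier G \<Longrightarrow> Vector_Spaces.linear scale scale (act g)"
    and act_isometry: "g \<in> carrier G \<Longrightarrow> nrm (act g v) = nrm v"

definition group_submodule ::
  "('f::field \<Rightarrow> 'v::ab_group_add \<Rightarrow> 'v) \<Rightarrow> ('g \<Rightarrow> 'v \<Rightarrow> 'v) \<Rightarrow> 'g set \<Rightarrow> 'v set \<Rightarrow> bool"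
  where "group_submodule scale act H U \<longleftrightarrow>
    module.subspace scale U \<and> (\<forall>h\<in>H. \<forall>u\<in>U. act h u \<in> U)"

section \<open>Quasi-cocycles\<close>

text \<open>
  \<open>QZ1 act nrm G W\<close> is the set of quasi-cocycles from the group \<open>G\<close> to \<open>W\<close>.  Being extensional
  functions, its elements are determined by their values on \<^term>\<open>carrier G\<close>; correspondingly, the
  pointwise vector space operations on it are restricted to \<^term>\<open>carrier G\<close>.
\<close>

definition QZ1 ::
  "('g \<Rightarrow> 'v::ab_group_add \<Rightarrow> 'v) \<Rightarrow> ('v \<Rightarrow> real) \<Rightarrow> ('g, 'b) monoid_scheme \<Rightarrow> 'v set \<Rightarrow> ('g \<Rightarrow> 'v) set"
  where "QZ1 act nrm G W =
    {q \<in> carrier G \<rightarrow>\<^sub>E W. \<exists>\<epsilon>>0. \<forall>f\<in>carrier G. \<forall>g\<in>carrier G.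
        nrm (q (f \<otimes>\<^bsub>G\<^esub> g) - q f - act f (q g)) \<le> \<epsilon>}"

section \<open>Hyperbolically embedded subgroups\<close>

text \<open>
  Letters are elements of the disjoint union of \<open>X\<close> and \<open>H - {\<one>}\<close>.  An arc \<open>(g, a, fwd)\<close> is the edge
  from \<open>g\<close> to \<open>g \<otimes> a\<close> labeled by the letter \<open>a\<close>, traversed forwards or backwards according to
  \<open>fwd\<close>.  Thus the directed walks of this multidigraph are the edge paths of the undirected Cayley
  graph, without assuming that \<open>X\<close> is closed under inverses.
\<close>

type_synonym 'g cayley_arc = "'g \<times> ('g + 'g) \<times> bool"

definition letter_val :: "'g + 'g \<Rightarrow> 'g"
  where "letter_val = case_sum id id"

definition cayley_graph ::
  "('g, 'b) monoid_scheme \<Rightarrow> 'g set \<Rightarrow> 'g set \<Rightarrow> ('g, 'g cayley_arc) pre_digraph"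
  where "cayley_graph G X H =
    \<lparr> verts = carrier G,
      arcs = carrier G \<times> (X <+> (H - {\<one>\<^bsub>G\<^esub>})) \<times> UNIV,
      tail = (\<lambda>(g, a, fwd). if fwd then g else g \<otimes>\<^bsub>G\<^esub> letter_val a),
      head = (\<lambda>(g, a, fwd). if fwd then g \<otimes>\<^bsub>G\<^esub> letter_val a else g) \<rparr>"

text \<open>
  The arcs of the complete subgraph on \<open>H\<close>.  An arc inside \<open>H\<close> labeled by a letter of \<open>X\<close> is not
  among them.
\<close>

definition subgroup_arcs :: "('g, 'b) monoid_scheme \<Rightarrow> 'g set \<Rightarrow> 'g cayley_arc set"
  where "subgroup_arcs G H = H \<times> Inr ` (H - {\<one>\<^bsub>G\<^esub>}) \<times> UNIV"

definition avoiding_dist :: "('a, 'e) pre_digraph \<Rightarrow> 'e set \<Rightarrow> 'a \<Rightarrow> 'a \<Rightarrow> enat"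
  where "avoiding_dist D A u v =
    (INF p \<in> {p. pre_digraph.awalk D u p v \<and> set p \<inter> A = {}}. enat (length p))"

abbreviation graph_dist :: "('a, 'e) pre_digraph \<Rightarrow> 'a \<Rightarrow> 'a \<Rightarrow> enat"
  where "graph_dist D \<equiv> avoiding_dist D {}"

definition gromov_product :: "('a \<Rightarrow> 'a \<Rightarrow> real) \<Rightarrow> 'a \<Rightarrow> 'a \<Rightarrow> 'a \<Rightarrow> real"
  where "gromov_product d w x y = (d x w + d y w - d x y) / 2"

definition gromov_hyperbolic :: "'a set \<Rightarrow> ('a \<Rightarrow> 'a \<Rightarrow> real) \<Rightarrow> bool"
  where "gromov_hyperbolic S d \<longleftrightarrow>
    (\<exists>\<delta>\<ge>0. \<forall>w\<in>S. \<forall>x\<in>S. \<forall>y\<in>S. \<forall>z\<in>S.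
      min (gromov_product d w x y) (gromov_product d w y z) - \<delta> \<le> gromov_product d w x z)"

text \<open>
  A connected graph is regarded as the metric space of its vertices with the path metric.  As the
  vertices are 1/2-dense in the geometric realization, this affects only the constant \<open>\<delta>\<close>.
\<close>

definition hyperbolic_graph :: "('a, 'e) pre_digraph \<Rightarrow> bool"
  where "hyperbolic_graph D \<longleftrightarrow>
    (\<forall>u\<in>verts D. \<forall>v\<in>verts D. graph_dist D u v \<noteq> \<infinity>) \<and>
    gromov_hyperbolic (verts D) (\<lambda>u v. real (the_enat (graph_dist D u v)))"

definition hat_dist :: "('g, 'b) monoid_scheme \<Rightarrow> 'g set \<Rightarrow> 'g set \<Rightarrow> 'g \<Rightarrow> 'g \<Rightarrow> enat"
  where "hat_dist G X H = avoiding_dist (cayley_graph G X H) (subgroup_arcs G H)"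

definition hyperbolically_embedded_wrt ::
  "('g, 'b) monoid_scheme \<Rightarrow> 'g set \<Rightarrow> 'g set \<Rightarrow> bool"
  where "hyperbolically_embedded_wrt G X H \<longleftrightarrow>
    subgroup H G \<and> X \<subseteq> carrier G \<and>
    generate G (X \<union> H) = carrier G \<and>
    hyperbolic_graph (cayley_graph G X H) \<and>
    (\<forall>h\<in>H. \<forall>n::nat. finite {k \<in> H. hat_dist G X H h k \<le> enat n})"

definition hyperbolically_embedded :: "('g, 'b) monoid_scheme \<Rightarrow> 'g set \<Rightarrow> bool"
  where "hyperbolically_embedded G H \<longleftrightarrow> (\<exists>X. hyperbolically_embedded_wrt G X H)"

end

theory Submission
  imports Defs "HOL-Algebra.Left_Coset"
begin

text \<open>
  Call the letters of \<open>X\<close> and \<open>H\<close> together the relative generators, let \<open>d\<close> be the word metric they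
  define, and let \<open>nearest B f\<close> be the set of points of a left coset \<open>B\<close> of \<open>H\<close> that are \<open>d\<close>-nearest
  to \<open>f\<close>.  Any two points of a coset are at distance at most 1, so the geometry of \<open>H\<close> is
  invisible to \<open>d\<close>; it is seen by the relation \<open>linked_off B n\<close>, which says that two points are
  joined by a path of length at most \<open>n\<close> without edges inside \<open>B\<close>.

  Hyperbolicity enters through one fact, \<open>linked_if_geodesic_off\<close>: if some geodesic from \<open>f\<close> to \<open>g\<close>
  has no edge inside \<open>B\<close>, then the nearest points of \<open>B\<close> to \<open>f\<close> and to \<open>g\<close> are linked off \<open>B\<close> by a
  path of bounded length.  So call \<open>B\<close> a separator of \<open>f\<close> and \<open>g\<close> if some of these nearest points
  are not linked off \<open>B\<close> within twice that bound.  Every geodesic from \<open>f\<close> to \<open>g\<close> then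
  has an edge inside \<open>B\<close>, it enters \<open>B\<close> in \<open>nearest B f\<close> and leaves it in \<open>nearest B g\<close>, and
  distinct separators are met at distinct distances from \<open>f\<close>.  In particular there are only
  finitely many separators, and a coset separating \<open>f\<close> from \<open>g\<close> separates, for half the
  threshold, \<open>f\<close> from \<open>h\<close> or \<open>h\<close> from \<open>g\<close>.

  Given a quasi-cocycle on \<open>H\<close>, replace it by its antisymmetrization \<open>\<phi>\<close>, which is at bounded
  distance, and put
  \<open>r(f, g) = \<Sum>B. mean of u \<cdot> \<phi>(u\<^sup>-\<^sup>1 v) over u \<in> nearest B f and v \<in> nearest B g\<close>, where \<open>B\<close> ranges
  over the separators of \<open>f\<close> and \<open>g\<close>.  This is equivariant, antisymmetric and linear in \<open>\<phi>\<close>,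
  so that \<open>g \<mapsto> r(1, g)\<close> is a quasi-cocycle as soon as \<open>r(f, g) + r(g, h) + r(h, f)\<close> is bounded.
  Each coset contributes a bounded amount to that sum, because \<open>\<phi>\<close> is a quasi-cocycle and takes
  only finitely many values below the threshold.  And at most six cosets contribute at all: if two
  cosets separate \<open>f\<close> both from \<open>g\<close> and from \<open>h\<close>, the one met first sees \<open>g\<close> and \<open>h\<close> only through
  the one met later, hence has the same nearest points to \<open>g\<close> as to \<open>h\<close>
  (\<open>nearest_eq_if_later_separator\<close>), and its contributions cancel by antisymmetry.

  On \<open>H\<close> itself the only possible separator of \<open>1\<close> and \<open>h\<close> is \<open>H\<close>, so the new quasi-cocycle
  agrees with \<open>\<phi>\<close> there, up to finitely many elements at which it vanishes.
\<close>

section \<open>Separation in hyperbolic graphs\<close>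

lemma relpow_sym: "sym R \<Longrightarrow> sym (R ^^ n)"
proof (induction n)
  case (Suc n)
  show ?case
  proof (rule symI)
    fix x y assume "(x, y) \<in> R ^^ Suc n"
    then obtain z where "(x, z) \<in> R" "(z, y) \<in> R ^^ n"
      by (meson relpow_Suc_E2)
    then show "(y, x) \<in> R ^^ Suc n"
      using Suc by (auto dest: symD)
  qed
qed (simp add: sym_Id)

lemma card_le_1_if_unique:
  assumes "\<And>x y. x \<in> A \<Longrightarrow> y \<in> A \<Longrightarrow> x = y" shows "finite A \<and> card A \<le> 1"
proof (cases "A = {}")
  case False
  then obtain x where "A = {x}"
    using assms by blast
  then show ?thesis by simp
qed simp

text \<open>
  The path metric on the vertices of a connected graph.  Integer values together with
  \<open>dist_between\<close> let distances play the part of geodesics, and \<open>four_point\<close> is the symmetric form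
  of Gromov's inequality, with \<open>\<delta>\<close> twice the usual constant.
\<close>

locale hyperbolic_graph_metric =
  fixes V :: "'a set" and d :: "'a \<Rightarrow> 'a \<Rightarrow> nat" and \<delta> :: nat
  assumes dist_eq_0_iff: "x \<in> V \<Longrightarrow> y \<in> V \<Longrightarrow> d x y = 0 \<longleftrightarrow> x = y"
    and dist_sym: "x \<in> V \<Longrightarrow> y \<in> V \<Longrightarrow> d x y = d y x"
    and dist_triangle: "x \<in> V \<Longrightarrow> y \<in> V \<Longrightarrow> z \<in> V \<Longrightarrow> d x z \<le> d x y + d y z"
    and dist_between: "x \<in> V \<Longrightarrow> y \<in> V \<Longrightarrow> m \<le> d x y \<Longrightarrow> \<exists>z\<in>V. d x z = m \<and> d z y = d x y - m"
    and four_point: "w \<in> V \<Longrightarrow> x \<in> V \<Longrightarrow> y \<in> V \<Longrightarrow> z \<in> V \<Longrightarrow>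
      d x z + d y w \<le> max (d x y + d z w) (d x w + d y z) + \<delta>"
begin

text \<open>
  Every edge with both ends in \<open>B\<close> is discarded, whatever its label.  Hence linked points of \<open>H\<close> are
  close in the metric of \<^const>\<open>hat_dist\<close>, while the relation itself depends on nothing but \<open>d\<close>.
\<close>

definition step_off :: "'a set \<Rightarrow> 'a rel"
  where "step_off B = {(x, y). x \<in> V \<and> y \<in> V \<and> d x y = 1 \<and> \<not> (x \<in> B \<and> y \<in> B)}"

definition linked_off :: "'a set \<Rightarrow> nat \<Rightarrow> 'a rel"
  where "linked_off B n = (\<Union>m\<le>n. step_off B ^^ m)"

definition clique :: "'a set \<Rightarrow> bool"
  where "clique B \<longleftrightarrow> B \<subseteq> V \<and> (\<forall>b\<in>B. \<forall>b'\<in>B. d b b' \<le> 1)"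

definition nearest :: "'a set \<Rightarrow> 'a \<Rightarrow> 'a set"
  where "nearest B f = {u \<in> B. \<forall>b\<in>B. d f u \<le> d f b}"

definition separated_by :: "'a set \<Rightarrow> nat \<Rightarrow> 'a \<Rightarrow> 'a \<Rightarrow> bool"
  where "separated_by B n f g \<longleftrightarrow> (\<exists>u\<in>nearest B f. \<exists>v\<in>nearest B g. (u, v) \<notin> linked_off B n)"

text \<open>
  With \<open>k = 2 * \<delta> + 3\<close> this is \<open>8 * k + 5\<close>, the length of the path built in
  \<open>linked_if_geodesic_off\<close>.
\<close>

definition link_bound :: nat
  where "link_bound = 16 * \<delta> + 29"

lemma sym_step_off: "sym (step_off B)"
  using dist_sym by (intro symI) (auto simp: step_off_def)

lemma linked_off_sym: "(x, y) \<in> linked_off B n \<Longrightarrow> (y, x) \<in> linked_off B n"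
  by (auto simp: linked_off_def intro: symD[OF relpow_sym[OF sym_step_off]])

lemma linked_off_trans:
  assumes "(x, y) \<in> linked_off B m" "(y, z) \<in> linked_off B n"
  shows "(x, z) \<in> linked_off B (m + n)"
proof -
  obtain i j where "i \<le> m" "j \<le> n" "(x, y) \<in> step_off B ^^ i" "(y, z) \<in> step_off B ^^ j"
    using assms by (auto simp: linked_off_def)
  then have "(x, z) \<in> step_off B ^^ (i + j)" "i + j \<le> m + n"
    by (auto intro: relpow_trans)
  then show ?thesis
    unfolding linked_off_def by blast
qed

lemma linked_off_mono: "(x, y) \<in> linked_off B m \<Longrightarrow> m \<le> n \<Longrightarrow> (x, y) \<in> linked_off B n"
  by (force simp: linked_off_def)

lemma linked_off_relpow: "(x, y) \<in> step_off B ^^ m \<Longrightarrow> m \<le> n \<Longrightarrow> (x, y) \<in> linked_off B n"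
  by (force simp: linked_off_def)

lemma step_off_relpow_dist_le:
  "(x, y) \<in> step_off B ^^ n \<Longrightarrow> x \<in> V \<Longrightarrow> y \<in> V \<and> d x y \<le> n"
proof (induction n arbitrary: y)
  case 0
  then show ?case using dist_eq_0_iff by auto
next
  case (Suc n)
  then obtain z where "(x, z) \<in> step_off B ^^ n" "(z, y) \<in> step_off B"
    by auto
  then show ?case
    using Suc.IH[of z] Suc.prems(2) dist_triangle[of x z y] by (auto simp: step_off_def)
qed

lemma cliqueD: "clique B \<Longrightarrow> b \<in> B \<Longrightarrow> b \<in> V"
    "clique B \<Longrightarrow> b \<in> B \<Longrightarrow> b' \<in> B \<Longrightarrow> d b b' \<le> 1"
  by (auto simp: clique_def)

lemma nearest_subset: "nearest B f \<subseteq> B"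
  by (auto simp: nearest_def)

text \<open>
  If no geodesic from \<open>x\<close> to \<open>y\<close> avoids the edges inside \<open>B\<close>, then there is a geodesic with an edge
  from \<open>p\<close> to \<open>p'\<close> inside \<open>B\<close>.  The conclusion says so in terms of distances.
\<close>

lemma geodesics_cross:
  assumes V: "x \<in> V" "y \<in> V" and B: "clique B"
    and "(x, y) \<notin> step_off B ^^ d x y"
  shows "\<exists>p\<in>B. \<exists>p'\<in>B. d x p + 1 + d p' y = d x y"
  using assms(1,4)
proof (induction "d x y" arbitrary: x)
  case 0
  then have "x = y" using V dist_eq_0_iff[of x y] by simp
  then show ?case using 0 by (metis relpow_0_I)
next
  case (Suc n)
  obtain z where z: "z \<in> V" "d x z = 1" "d z y = n"
    using dist_between[of x y 1] Suc.prems(1) Suc.hyps(2) V by auto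
  show ?case
  proof (cases "(z, y) \<in> step_off B ^^ n")
    case True
    then have "(x, z) \<notin> step_off B"
      using Suc.prems(2) Suc.hyps(2)[symmetric] by (metis relpow_Suc_I2)
    then have "x \<in> B" "z \<in> B"
      using z Suc.prems(1) by (auto simp: step_off_def)
    moreover have "d x x = 0"
      using dist_eq_0_iff Suc.prems(1) by blast
    ultimately show ?thesis
      using z Suc.hyps(2) by force
  next
    case False
    then obtain p p' where p: "p \<in> B" "p' \<in> B" "d z p + 1 + d p' y = n"
      using Suc.hyps(1)[of z] z by auto
    have V': "p \<in> V" "p' \<in> V"
      using p cliqueD(1)[OF B] by auto
    have "d x p \<le> 1 + d z p"
      using dist_triangle[of x z p] z V' Suc.prems(1) by simp
    moreover have "d x y \<le> d x p + d p p' + d p' y"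
      using dist_triangle[of x p y] dist_triangle[of p p' y] V V' Suc.prems(1) by linarith
    ultimately have "d x p + 1 + d p' y = d x y"
      using p cliqueD(2)[OF B, of p p'] Suc.hyps(2) by linarith
    then show ?thesis
      using p by blast
  qed
qed

lemma nearest_nonempty:
  assumes "B \<noteq> {}" shows "nearest B f \<noteq> {}"
proof -
  obtain b where "b \<in> B"
    using assms by blast
  then show ?thesis
    using ex_has_least_nat[of "\<lambda>u. u \<in> B" b "d f"] by (auto simp: nearest_def)
qed

text \<open>
  A geodesic leaving \<open>B\<close> from a nearest point does not return to \<open>B\<close>, since that would give a
  shortcut.
\<close>

lemma geodesic_from_nearest:
  assumes V: "a \<in> V" "g \<in> V" and B: "clique B"
    and v: "v \<in> nearest B g" and a: "d v a + d a g = d v g"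
  shows "(v, a) \<in> step_off B ^^ d v a"
proof (rule ccontr)
  assume *: "\<not> ?thesis"
  have vV: "v \<in> V"
    using v cliqueD[OF B] by (auto simp: nearest_def)
  obtain p p' where p: "p \<in> B" "p' \<in> B" "d v p + 1 + d p' a = d v a"
    using geodesics_cross[OF vV V(1) B *] by blast
  have "d p' g \<le> d p' a + d a g"
    using dist_triangle[of p' a g] p cliqueD[OF B] V by auto
  moreover have "d g v \<le> d g p'"
    using v p by (auto simp: nearest_def)
  moreover have "d g v = d v g" "d g p' = d p' g"
    using dist_sym V vV p cliqueD[OF B] by auto
  ultimately show False
    using p(3) a by linarith
qed

lemma geodesic_away:
  assumes V: "a \<in> V" "a' \<in> V" and B: "clique B"
    and away: "\<And>b. b \<in> B \<Longrightarrow> d a a' < d a b"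
  shows "(a, a') \<in> step_off B ^^ d a a'"
proof (rule ccontr)
  assume "\<not> ?thesis"
  then obtain p p' where "p \<in> B" "d a p + 1 + d p' a' = d a a'"
    using geodesics_cross[OF V B] by blast
  with away[of p] show False by simp
qed

text \<open>
  Geodesics fellow-travel: \<open>E\<close> bounds twice the Gromov product of \<open>x\<close> and \<open>z\<close> at \<open>a\<close>, and
  \<open>t\<close> is the position on a geodesic from \<open>x\<close> to \<open>z\<close> that balances the two sums in the four-point condition.
\<close>

lemma close_to_geodesic:
  assumes V: "a \<in> V" "x \<in> V" "z \<in> V" and E: "d x a + d a z \<le> d x z + E"
  shows "\<exists>t\<le>d x z. \<forall>p\<in>V. d x p = t \<longrightarrow> d p z = d x z - t \<longrightarrow> d a p \<le> E + \<delta> + 1"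
proof -
  define t where "t = (d x a + d x z - d a z) div 2"
  have tri: "d a z \<le> d x a + d x z" "d x a \<le> d x z + d a z"
    using dist_triangle[of a x z] dist_triangle[of x z a] dist_sym[of x a] dist_sym[of a z] V
    by auto
  have "t \<le> d x z"
    using tri by (simp add: t_def)
  moreover have "d a p \<le> E + \<delta> + 1" if p: "p \<in> V" "d x p = t" "d p z = d x z - t" for p
  proof -
    have "d x z + d a p \<le> max (d x a + d z p) (d x p + d a z) + \<delta>"
      using four_point[of p x a z] p V by simp
    moreover have "d z p = d p z"
      using p V dist_sym by auto
    ultimately show ?thesis
      using p(2,3) E tri unfolding t_def by linarith
  qed
  ultimately show ?thesis by blast
qed

text \<open>
  Thin triangles.  The Gromov product of \<open>x\<close> and \<open>y\<close> at a point \<open>a\<close> between them vanishes, so one of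
  the other two products at \<open>a\<close> is at most \<open>\<delta> / 2\<close>.
\<close>

lemma near_some_side:
  assumes V: "a \<in> V" "x \<in> V" "y \<in> V" "z \<in> V" and a: "d x a + d a y = d x y"
  shows "d x a + d a z \<le> d x z + \<delta> \<or> d y a + d a z \<le> d y z + \<delta>"
proof -
  have "d x y + d a z \<le> max (d x a + d y z) (d x z + d a y) + \<delta>"
    using four_point[of z x a y] V by simp
  then show ?thesis
    using a V dist_sym[of a y] by linarith
qed

text \<open>
  In the quadrilateral \<open>f, u, v, g\<close> take the point \<open>a\<close> of the side from \<open>u\<close> to \<open>f\<close> at distance
  \<open>2 * \<delta> + 4\<close> from \<open>u\<close>, or \<open>f\<close> itself if that side is shorter.  By thinness \<open>a\<close> is close either to
  the side from \<open>v\<close> to \<open>g\<close>, which yields a short path from \<open>u\<close> to \<open>v\<close>, or to the side from \<open>f\<close> to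
  \<open>g\<close>.  The connecting paths are shorter than the distance from \<open>a\<close> to \<open>B\<close>, so they stay off \<open>B\<close>.
  The second alternative names only the position \<open>t\<close> on the side from \<open>f\<close> to \<open>g\<close>, so that it holds
  for every geodesic.
\<close>

lemma nearest_linked_or_detour:
  assumes V: "f \<in> V" "g \<in> V" and B: "clique B"
    and u: "u \<in> nearest B f" and v: "v \<in> nearest B g"
  shows "(u, v) \<in> linked_off B (8 * \<delta> + 15) \<or>
    (\<exists>a\<in>V. d u a \<le> 2 * \<delta> + 4 \<and> (u, a) \<in> linked_off B (2 * \<delta> + 4) \<and>
      (\<exists>t\<le>d f g. \<forall>p\<in>V. d f p = t \<longrightarrow> d p g = d f g - t \<longrightarrow>
        d a p \<le> 2 * \<delta> + 3 \<and> (a, p) \<in> linked_off B (2 * \<delta> + 3)))"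
proof -
  define k where "k = 2 * \<delta> + 3"
  have uv: "u \<in> V" "v \<in> V" "u \<in> B" "v \<in> B" "d u v \<le> 1" "d v u \<le> 1"
    using u v cliqueD[OF B] by (auto simp: nearest_def)
  obtain a where a: "a \<in> V" "d u a = min (k + 1) (d u f)" "d a f = d u f - min (k + 1) (d u f)"
    using dist_between[of u f "min (k + 1) (d u f)"] uv V by auto
  have auf: "d u a + d a f = d u f"
    using a by simp
  have ua: "(u, a) \<in> linked_off B (k + 1)"
    using geodesic_from_nearest[OF a(1) V(1) B u auf] a(2) by (intro linked_off_relpow) auto
  \<comment> \<open>\<open>u\<close> is nearest to \<open>a\<close> as well, so paths from \<open>a\<close> shorter than \<open>d u a\<close> do not meet \<open>B\<close>.\<close>
  have far: "d u a \<le> d a b" if "b \<in> B" for b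
  proof -
    have "d f u \<le> d f b"
      using u that by (auto simp: nearest_def)
    moreover have "d f b \<le> d f a + d a b"
      using dist_triangle[of f a b] V a cliqueD[OF B] that by auto
    ultimately show ?thesis
      using auf dist_sym[of f u] dist_sym[of f a] V uv a(1) by linarith
  qed
  show ?thesis
  proof (cases "d u f \<le> k")
    case True
    then have "d a f = 0" using a by simp
    then have "a = f" using a V dist_eq_0_iff by blast
    have "d a p \<le> k \<and> (a, p) \<in> linked_off B k" if "p \<in> V" "d f p = 0" for p
    proof -
      have "p = f"
        using that V dist_eq_0_iff by blast
      then show ?thesis
        using that \<open>a = f\<close> by (auto simp: linked_off_def intro!: bexI[of _ 0])
    qed
    then have "\<exists>t\<le>d f g. \<forall>p\<in>V. d f p = t \<longrightarrow> d p g = d f g - t \<longrightarrow> d a p \<le> k \<and> (a, p) \<in> linked_off B k"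
      by (intro exI[of _ 0]) auto
    moreover have "d u a \<le> k + 1"
      using a(2) by simp
    ultimately show ?thesis
      using a(1) ua unfolding k_def by (intro disjI2 bexI[of _ a]) (simp_all add: add.commute)
  next
    case False
    then have dua: "d u a = k + 1" using a by simp
    have link: "(a, p) \<in> linked_off B k" if "p \<in> V" "d a p \<le> k" for p
    proof -
      have "(a, p) \<in> step_off B ^^ d a p"
        using geodesic_away[OF a(1) that(1) B] far dua that by fastforce
      then show ?thesis
        using that by (auto intro: linked_off_relpow)
    qed
    consider "d u a + d a g \<le> d u g + \<delta>" | "d f a + d a g \<le> d f g + \<delta>"
      using near_some_side[OF a(1) uv(1) V auf] by blast
    then show ?thesis
    proof cases
      case 1
      have "d v a \<le> 1 + d u a" "d u g \<le> 1 + d v g"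
        using dist_triangle[of v u a] dist_triangle[of u v g] uv V a by auto
      then have "d v a + d a g \<le> d v g + (\<delta> + 2)"
        using 1 by linarith
      then obtain t where t: "t \<le> d v g"
          "\<And>p. p \<in> V \<Longrightarrow> d v p = t \<Longrightarrow> d p g = d v g - t \<Longrightarrow> d a p \<le> k"
        using close_to_geodesic[OF a(1) uv(2) V(2), of "\<delta> + 2"] unfolding k_def by fastforce
      obtain p where p: "p \<in> V" "d v p = t" "d p g = d v g - t"
        using dist_between[of v g t] t(1) uv V by auto
      have ap: "d a p \<le> k"
        using t p by auto
      have "(v, p) \<in> step_off B ^^ d v p"
        using geodesic_from_nearest[OF p(1) V(2) B v] p t(1) by auto
      moreover have "d v p \<le> d v u + d u a + d a p"
        using dist_triangle[of v a p] dist_triangle[of v u a] uv a p by linarith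
      ultimately have "(v, p) \<in> linked_off B (2 * k + 2)"
        using ap dua uv by (auto intro: linked_off_relpow)
      then have "(u, v) \<in> linked_off B ((k + 1) + k + (2 * k + 2))"
        using linked_off_trans[OF linked_off_trans[OF ua link[OF p(1) ap]]] linked_off_sym by blast
      then show ?thesis
        by (simp add: k_def add.commute)
    next
      case 2
      obtain t where t: "t \<le> d f g"
          "\<forall>p\<in>V. d f p = t \<longrightarrow> d p g = d f g - t \<longrightarrow> d a p \<le> \<delta> + \<delta> + 1"
        using close_to_geodesic[OF a(1) V(1,2) 2] by blast
      have "d a p \<le> k \<and> (a, p) \<in> linked_off B k"
        if "p \<in> V" "d f p = t" "d p g = d f g - t" for p
      proof -
        have "d a p \<le> k"
          using t(2) that unfolding k_def by force
        then show ?thesis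
          using link that(1) by blast
      qed
      then have "\<exists>t\<le>d f g. \<forall>p\<in>V. d f p = t \<longrightarrow> d p g = d f g - t \<longrightarrow> d a p \<le> k \<and> (a, p) \<in> linked_off B k"
        using t(1) by blast
      then show ?thesis
        using a(1) ua dua unfolding k_def by (intro disjI2 bexI[of _ a]) (simp_all add: add.commute)
    qed
  qed
qed

text \<open>
  This is how hyperbolicity enters.  If a geodesic from \<open>f\<close> to \<open>g\<close> stays off \<open>B\<close>, the points \<open>a\<close> and
  \<open>b\<close> found near \<open>u\<close> and near \<open>v\<close> by \<open>nearest_linked_or_detour\<close> can be joined along that geodesic,
  and the stretch used is short because its ends are close to \<open>u\<close> and \<open>v\<close>.
\<close>

lemma linked_if_geodesic_off:
  assumes V: "f \<in> V" "g \<in> V" and B: "clique B"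
    and u: "u \<in> nearest B f" and v: "v \<in> nearest B g"
    and off: "(f, g) \<in> step_off B ^^ d f g"
  shows "(u, v) \<in> linked_off B link_bound"
proof (rule ccontr)
  assume not_linked: "\<not> ?thesis"
  define k where "k = 2 * \<delta> + 3"
  define L where "L = d f g"
  have uv: "u \<in> V" "v \<in> V" "d u v \<le> 1"
    using u v cliqueD[OF B] by (auto simp: nearest_def)
  have "(u, v) \<notin> linked_off B (8 * \<delta> + 15)" and "(v, u) \<notin> linked_off B (8 * \<delta> + 15)"
    using not_linked linked_off_mono[of _ _ B "8 * \<delta> + 15" link_bound] linked_off_sym[of v u]
    by (auto simp: link_bound_def)
  moreover have k: "2 * \<delta> + 3 = k" "2 * \<delta> + 4 = k + 1"
    by (simp_all add: k_def)
  moreover have "d g f = L"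
    using dist_sym V by (simp add: L_def)
  ultimately obtain a t b s where a: "a \<in> V" "d u a \<le> k + 1" "(u, a) \<in> linked_off B (k + 1)" "t \<le> L"
      and a': "\<forall>p\<in>V. d f p = t \<longrightarrow> d p g = L - t \<longrightarrow> d a p \<le> k \<and> (a, p) \<in> linked_off B k"
      and b: "b \<in> V" "d v b \<le> k + 1" "(v, b) \<in> linked_off B (k + 1)" "s \<le> L"
      and b': "\<forall>p\<in>V. d g p = s \<longrightarrow> d p f = L - s \<longrightarrow> d b p \<le> k \<and> (b, p) \<in> linked_off B k"
    using nearest_linked_or_detour[OF V B u v, unfolded k, folded L_def]
      nearest_linked_or_detour[OF V(2,1) B v u, unfolded k]
    by (elim disjE bexE exE conjE) (simp, simp, simp, blast)
  obtain \<gamma> where \<gamma>: "\<gamma> 0 = f" "\<gamma> L = g" "\<And>i. i < L \<Longrightarrow> (\<gamma> i, \<gamma> (Suc i)) \<in> step_off B"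
    using off unfolding L_def relpow_fun_conv by auto
  have seg: "(\<gamma> i, \<gamma> j) \<in> step_off B ^^ (j - i)" if "i \<le> j" "j \<le> L" for i j
    unfolding relpow_fun_conv using that \<gamma> by (intro exI[of _ "\<lambda>l. \<gamma> (i + l)"]) auto
  have pos: "\<gamma> i \<in> V \<and> d f (\<gamma> i) = i \<and> d (\<gamma> i) g = L - i" if "i \<le> L" for i
  proof -
    have "\<gamma> i \<in> V \<and> d f (\<gamma> i) \<le> i" "d (\<gamma> i) g \<le> L - i"
      using step_off_relpow_dist_le[OF seg[of 0 i]] step_off_relpow_dist_le[OF seg[of i L]] \<gamma> that V
      by auto
    moreover have "L \<le> d f (\<gamma> i) + d (\<gamma> i) g"
      using dist_triangle[of f "\<gamma> i" g] calculation V by (simp add: L_def)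
    ultimately show ?thesis using that by linarith
  qed
  define p q where "p = \<gamma> t" and "q = \<gamma> (L - s)"
  have p: "p \<in> V" "d f p = t" "d p g = L - t"
    using pos[OF a(4)] by (auto simp: p_def)
  have q: "q \<in> V" "d f q = L - s" "d q g = s"
    using pos[of "L - s"] b(4) by (auto simp: q_def)
  have ap: "d a p \<le> k" "(a, p) \<in> linked_off B k"
    using a' p by auto
  have bq: "d b q \<le> k" "(b, q) \<in> linked_off B k"
    using b' q dist_sym V by auto
  have "d p q \<le> d p a + (d a u + (d u v + (d v b + d b q)))"
    using dist_triangle[of p a q] dist_triangle[of a u q] dist_triangle[of u v q]
      dist_triangle[of v b q] p q a b uv by linarith
  moreover have "d p a = d a p" "d a u = d u a"
    using dist_sym p a uv by auto
  ultimately have pq: "d p q \<le> 4 * k + 3"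
    using ap bq a b uv by linarith
  have "t \<le> (L - s) + d p q" "L - s \<le> t + d p q"
    using dist_triangle[of f p q] dist_triangle[of f q p] dist_sym[of p q] p q V by auto
  then have "(p, q) \<in> linked_off B (4 * k + 3)"
    using seg[of t "L - s"] seg[of "L - s" t] a(4) pq
    unfolding p_def[symmetric] q_def[symmetric]
    by (cases "t \<le> L - s") (auto intro: linked_off_relpow linked_off_relpow[THEN linked_off_sym])
  then have "(u, v) \<in> linked_off B ((k + 1) + k + (4 * k + 3) + k + (k + 1))"
    using linked_off_trans[OF linked_off_trans[OF linked_off_trans[OF linked_off_trans[OF
      a(3) ap(2)] _ ] linked_off_sym[OF bq(2)]] linked_off_sym[OF b(3)]] by blast
  then show False
    using not_linked by (simp add: k_def link_bound_def add.commute)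
qed

lemma separated_by_sym: "separated_by B n f g \<Longrightarrow> separated_by B n g f"
  unfolding separated_by_def using linked_off_sym by blast

lemma separated_by_mono: "separated_by B n f g \<Longrightarrow> m \<le> n \<Longrightarrow> separated_by B m f g"
  unfolding separated_by_def using linked_off_mono by blast

lemma separated_not_geodesic_off:
  assumes "f \<in> V" "g \<in> V" "clique B"
    and "separated_by B link_bound f g"
  shows "(f, g) \<notin> step_off B ^^ d f g"
proof
  assume off: "(f, g) \<in> step_off B ^^ d f g"
  obtain u v where "u \<in> nearest B f" "v \<in> nearest B g" "(u, v) \<notin> linked_off B link_bound"
    using assms(4) by (auto simp: separated_by_def)
  then show False
    using linked_if_geodesic_off[OF assms(1-3) _ _ off] by blast
qed

lemma not_separated_from_self:
  assumes "f \<in> V" "clique B"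
  shows "\<not> separated_by B link_bound f f"
proof -
  have "d f f = 0"
    using dist_eq_0_iff assms(1) by blast
  then have "(f, f) \<in> step_off B ^^ d f f"
    by simp
  then show ?thesis
    using separated_not_geodesic_off[OF assms(1) assms] by blast
qed

text \<open>
  A geodesic can be chosen to enter a separator at any point nearest to \<open>f\<close> and to leave it at any
  point nearest to \<open>g\<close>.
\<close>

lemma separated_dist:
  assumes V: "f \<in> V" "g \<in> V" and B: "clique B"
    and sep: "separated_by B link_bound f g"
    and u: "u \<in> nearest B f" and v: "v \<in> nearest B g"
  shows "d f g = d f u + 1 + d v g"
proof -
  obtain p p' where p: "p \<in> B" "p' \<in> B" "d f p + 1 + d p' g = d f g"
    using geodesics_cross[OF V B separated_not_geodesic_off[OF V B sep]] by blast
  have "u \<in> B" "v \<in> B" "d f u \<le> d f p" "d g v \<le> d g p'"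
    using u v p by (auto simp: nearest_def)
  moreover have "d f g \<le> d f u + d u v + d v g"
    using dist_triangle[of f u g] dist_triangle[of u v g] V calculation cliqueD[OF B] by fastforce
  moreover have "d u v \<le> 1"
    using calculation cliqueD[OF B] by blast
  moreover have "d g v = d v g" "d g p' = d p' g"
    using dist_sym V p calculation cliqueD[OF B] by blast+
  ultimately show ?thesis
    using p(3) by linarith
qed

lemma nearestI_dist_le: "u \<in> nearest B f \<Longrightarrow> v \<in> B \<Longrightarrow> d f v \<le> d f u \<Longrightarrow> v \<in> nearest B f"
  by (force simp: nearest_def)

text \<open>
  If \<open>B0\<close> is met after \<open>B\<close>, then the way from \<open>f\<close> to a point \<open>p\<close> of \<open>B0\<close> can be led through any
  given \<open>v\<close>: no geodesic from \<open>f\<close> to \<open>g\<close> avoids \<open>B0\<close>, and a geodesic through \<open>v\<close> cannot meet \<open>B0\<close>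
  before \<open>v\<close>.
\<close>

lemma later_passage:
  assumes V: "f \<in> V" "g \<in> V"
    and B: "clique B"
    and B0: "clique B0"
    and sep: "separated_by B link_bound f g" "separated_by B0 link_bound f g"
    and u: "u \<in> nearest B f" and u0: "u0 \<in> nearest B0 f" and less: "d f u < d f u0"
    and v: "v \<in> nearest B g"
  shows "\<exists>p\<in>nearest B0 f. d f v + d v p = d f p"
proof -
  have vV: "v \<in> V" "u \<in> V" "d u v \<le> 1"
    using u v cliqueD[OF B] by (auto simp: nearest_def)
  have fg: "d f g = d f u + 1 + d v g"
    using separated_dist[OF V B sep(1) u v] .
  have fv: "d f v = d f u + 1"
    using dist_triangle[of f u v] dist_triangle[of f v g] V vV fg by linarith
  have "(v, g) \<notin> step_off B0 ^^ d v g"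
  proof
    assume *: "(v, g) \<in> step_off B0 ^^ d v g"
    have "(f, v) \<notin> step_off B0 ^^ d f v"
    proof
      assume "(f, v) \<in> step_off B0 ^^ d f v"
      then have "(f, g) \<in> step_off B0 ^^ (d f v + d v g)"
        using * by (rule relpow_trans)
      then show False
        using separated_not_geodesic_off[OF V B0 sep(2)] fv fg by simp
    qed
    then obtain p p' where p: "p \<in> B0" "d f p + 1 + d p' v = d f v"
      using geodesics_cross[OF V(1) vV(1) B0] by blast
    moreover have "d f u0 \<le> d f p"
      using p u0 by (auto simp: nearest_def)
    ultimately show False
      using fv less by linarith
  qed
  then obtain p p' where p: "p \<in> B0" "p' \<in> B0" "d v p + 1 + d p' g = d v g"
    using geodesics_cross[OF vV(1) V(2) B0] by blast
  obtain w where w: "w \<in> nearest B0 g"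
    using nearest_nonempty[of B0 g] p by auto
  have "d f g = d f u0 + 1 + d w g"
    using separated_dist[OF V B0 sep(2) u0 w] .
  moreover have "d g w \<le> d g p'"
    using w p by (auto simp: nearest_def)
  moreover have "d g w = d w g" "d g p' = d p' g"
    using dist_sym V p w cliqueD[OF B0] by (auto simp: nearest_def)
  moreover have "d f p \<le> d f v + d v p"
    using dist_triangle[of f v p] V vV p cliqueD[OF B0] by auto
  moreover have "d f u0 \<le> d f p"
    using p u0 by (auto simp: nearest_def)
  ultimately have "d f v + d v p = d f p" "d f p \<le> d f u0"
    using fg fv p(3) by linarith+
  then show ?thesis
    using nearestI_dist_le[OF u0 p(1)] by blast
qed

text \<open>
  Splicing: a geodesic from \<open>f\<close> through \<open>v\<close> to a nearest point of \<open>B0\<close> continues to \<open>h\<close> just as well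
  as to \<open>g\<close>, so \<open>v\<close> lies on a geodesic from \<open>f\<close> to \<open>h\<close>.
\<close>

lemma nearest_subset_if_later_separator:
  assumes V: "f \<in> V" "g \<in> V" "h \<in> V"
    and B: "clique B"
    and B0: "clique B0"
    and sep_g: "separated_by B link_bound f g" "separated_by B0 link_bound f g"
    and sep_h: "separated_by B link_bound f h" "separated_by B0 link_bound f h"
    and u: "u \<in> nearest B f" and u0: "u0 \<in> nearest B0 f" and less: "d f u < d f u0"
  shows "nearest B g \<subseteq> nearest B h"
proof
  fix v assume v: "v \<in> nearest B g"
  have "v \<in> B" "u \<in> B"
    using v u by (auto simp: nearest_def)
  then have vB: "v \<in> B" "v \<in> V" "d u v \<le> 1" "u \<in> V"
    using cliqueD[OF B] by blast+
  obtain p where p: "p \<in> nearest B0 f" "d f v + d v p = d f p"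
    using later_passage[OF V(1,2) B B0 sep_g u u0 less v] by blast
  have pB: "p \<in> B0" "p \<in> V"
    using p(1) cliqueD(1)[OF B0] by (auto simp: nearest_def)
  obtain w0 w where w: "w0 \<in> nearest B0 h" "w \<in> nearest B h"
    using nearest_nonempty[of B0 h] nearest_nonempty[of B h] pB(1) vB(1) by blast
  have wB: "w0 \<in> B0" "w0 \<in> V" "w \<in> V"
    using w cliqueD(1)[OF B] cliqueD(1)[OF B0] by (auto simp: nearest_def)
  have "d f h = d f p + 1 + d w0 h"
    using separated_dist[OF V(1,3) B0 sep_h(2) p(1) w(1)] .
  moreover have "d f h = d f u + 1 + d w h"
    using separated_dist[OF V(1,3) B sep_h(1) u w(2)] .
  moreover have "d f v = d f u + 1"
    using separated_dist[OF V(1,2) B sep_g(1) u v] dist_triangle[of f u v] dist_triangle[of f v g]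
      V vB by linarith
  moreover have "d v h \<le> d v p + d p w0 + d w0 h"
    using dist_triangle[OF vB(2) pB(2) V(3)] dist_triangle[OF pB(2) wB(2) V(3)] by linarith
  moreover have "d p w0 \<le> 1"
    using cliqueD(2)[OF B0] pB wB by blast
  ultimately have "d v h \<le> d w h"
    using p(2) by linarith
  then show "v \<in> nearest B h"
    using nearestI_dist_le[OF w(2) vB(1)] dist_sym V vB wB by simp
qed

lemma nearest_eq_if_later_separator:
  assumes V: "f \<in> V" "g \<in> V" "h \<in> V"
    and B: "clique B"
    and B0: "clique B0"
    and sep_g: "separated_by B link_bound f g" "separated_by B0 link_bound f g"
    and sep_h: "separated_by B link_bound f h" "separated_by B0 link_bound f h"
    and u: "u \<in> nearest B f" and u0: "u0 \<in> nearest B0 f" and less: "d f u < d f u0"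
  shows "nearest B g = nearest B h"
  using nearest_subset_if_later_separator[OF V B B0 sep_g sep_h u u0 less]
    nearest_subset_if_later_separator[OF V(1,3,2) B B0 sep_h sep_g u u0 less] by blast

text \<open>
  A geodesic has only one edge at a given position.  If both separators were met at the same
  distance, the geodesic from \<open>f\<close> through \<open>u\<close> and \<open>v\<close> to \<open>g\<close> would avoid \<open>B0\<close> altogether.
\<close>

lemma disjoint_separators_dist_neq:
  assumes V: "f \<in> V" "g \<in> V"
    and B: "clique B"
    and B0: "clique B0"
    and disj: "B \<inter> B0 = {}"
    and sep: "separated_by B link_bound f g" "separated_by B0 link_bound f g"
    and u: "u \<in> nearest B f" and u0: "u0 \<in> nearest B0 f"
  shows "d f u \<noteq> d f u0"
proof
  assume eq: "d f u = d f u0"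
  have uV: "u \<in> V" "u \<in> B" "u0 \<in> B0"
    using u u0 cliqueD[OF B] by (auto simp: nearest_def)
  obtain v w where v: "v \<in> nearest B g" and w: "w \<in> nearest B0 g"
    using nearest_nonempty[of B g] nearest_nonempty[of B0 g] uV by blast
  have vV: "v \<in> V" "v \<in> B" "d u v \<le> 1"
    using v u cliqueD[OF B] by (auto simp: nearest_def)
  have wV: "w \<in> V"
    using w cliqueD[OF B0] by (auto simp: nearest_def)
  have fg: "d f g = d f u + 1 + d v g" "d f g = d f u0 + 1 + d w g"
    using separated_dist[OF V B sep(1) u v] separated_dist[OF V B0 sep(2) u0 w] .
  have uv: "d u v = 1"
    using dist_triangle[of f u g] dist_triangle[of u v g] V uV vV fg(1) by linarith
  have fu: "(f, u) \<in> step_off B0 ^^ d f u"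
  proof (rule ccontr)
    assume "\<not> ?thesis"
    then obtain p p' where "p \<in> B0" "d f p + 1 + d p' u = d f u"
      using geodesics_cross[OF V(1) uV(1) B0] by blast
    moreover have "d f u0 \<le> d f p"
      using u0 \<open>p \<in> B0\<close> by (auto simp: nearest_def)
    ultimately show False
      using eq by linarith
  qed
  have "(v, g) \<in> step_off B0 ^^ d v g"
  proof (rule ccontr)
    assume "\<not> ?thesis"
    then obtain p p' where p: "p' \<in> B0" "d v p + 1 + d p' g = d v g"
      using geodesics_cross[OF vV(1) V(2) B0] by blast
    moreover have "d g w \<le> d g p'"
      using w p by (auto simp: nearest_def)
    moreover have "d g w = d w g" "d g p' = d p' g"
      using dist_sym V p wV cliqueD[OF B0] by blast+
    ultimately show False
      using eq fg by linarith
  qed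
  moreover have "(u, v) \<in> step_off B0"
    using uV vV disj uv by (auto simp: step_off_def)
  ultimately have "(u, g) \<in> step_off B0 ^^ Suc (d v g)"
    by (rule relpow_Suc_I2[rotated])
  with fu have "(f, g) \<in> step_off B0 ^^ (d f u + Suc (d v g))"
    by (rule relpow_trans)
  then show False
    using separated_not_geodesic_off[OF V B0 sep(2)] fg(1) by simp
qed

lemma finite_separators:
  assumes V: "f \<in> V" "g \<in> V"
    and \<B>: "\<And>B. B \<in> \<B> \<Longrightarrow> clique B"
      "pairwise disjnt \<B>"
  shows "finite {B \<in> \<B>. separated_by B link_bound f g}" (is "finite ?S")
proof -
  define entry where "entry B = (SOME u. u \<in> nearest B f)" for B
  have entry: "entry B \<in> nearest B f" if "B \<in> ?S" for B
    unfolding entry_def using that by (auto simp: separated_by_def intro: someI)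
  have "inj_on (\<lambda>B. d f (entry B)) ?S"
  proof (rule inj_onI, rule ccontr)
    fix B B0 assume *: "B \<in> ?S" "B0 \<in> ?S" "d f (entry B) = d f (entry B0)" "B \<noteq> B0"
    have "B \<inter> B0 = {}"
      using * \<B>(2) by (auto simp: pairwise_def disjnt_def)
    then show False
      using disjoint_separators_dist_neq[OF V, of B B0] \<B>(1) * entry[OF *(1)] entry[OF *(2)]
      by blast
  qed
  moreover have "(\<lambda>B. d f (entry B)) ` ?S \<subseteq> {..d f g}"
  proof safe
    fix B assume B: "B \<in> \<B>" "separated_by B link_bound f g"
    obtain v where "v \<in> nearest B g"
      using B(2) by (auto simp: separated_by_def)
    then show "d f (entry B) \<le> d f g"
      using separated_dist[OF V, of B "entry B" v] entry[of B] \<B>(1) B by fastforce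
  qed
  ultimately show ?thesis
    by (meson finite_atMost finite_subset inj_on_finite)
qed

text \<open>
  The contrapositive of the triangle inequality for linking, at nearest points to the three corners.
\<close>

lemma separated_triangle:
  assumes "separated_by B (m + n) f g" and h: "nearest B h \<noteq> {}"
  shows "separated_by B m f h \<or> separated_by B n h g"
proof -
  obtain u v w where "u \<in> nearest B f" "v \<in> nearest B g" "w \<in> nearest B h"
      "(u, v) \<notin> linked_off B (m + n)"
    using assms by (auto simp: separated_by_def)
  moreover have "(u, w) \<notin> linked_off B m \<or> (w, v) \<notin> linked_off B n"
    using calculation linked_off_trans by blast
  ultimately show ?thesis
    unfolding separated_by_def by blast
qed

end

section \<open>Separating cosets\<close>

text \<open>
  The data that a hyperbolically embedded subgroup leaves behind once the generating set is
  forgotten.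
\<close>

locale hyperbolic_coset_geometry =
  group G + hyperbolic_graph_metric "carrier G" d \<delta>
  for G :: "('g, 'b) monoid_scheme" (structure) and d \<delta> +
  fixes H :: "'g set"
  assumes subgroup_H: "subgroup H G"
    and dist_mult_left: "\<lbrakk>g \<in> carrier G; x \<in> carrier G; y \<in> carrier G\<rbrakk> \<Longrightarrow> d (g \<otimes> x) (g \<otimes> y) = d x y"
    and clique_H: "clique H"
    and finite_linked: "finite {h \<in> H. (\<one>, h) \<in> linked_off H n}"
begin

lemma H_subset: "H \<subseteq> carrier G"
  using subgroup_H by (rule subgroup.subset)

lemma l_coset_eq_image: "g <# B = (\<lambda>b. g \<otimes> b) ` B"
  by (auto simp: l_coset_def)

lemma mem_l_coset_iff:
  "g \<in> carrier G \<Longrightarrow> x \<in> carrier G \<Longrightarrow> B \<subseteq> carrier G \<Longrightarrow> g \<otimes> x \<in> g <# B \<longleftrightarrow> x \<in> B"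
  unfolding l_coset_eq_image by (auto simp: subset_iff)

lemma l_coset_inv_cancel:
  "g \<in> carrier G \<Longrightarrow> B \<subseteq> carrier G \<Longrightarrow> inv g <# (g <# B) = B"
  by (simp add: lcos_m_assoc lcos_mult_one)

lemma l_coset_in_lcosets:
  assumes "g \<in> carrier G" "B \<in> lcosets H" shows "g <# B \<in> lcosets H"
  using assms lcos_m_assoc[OF H_subset] unfolding LCOSETS_def by auto

lemma lcoset_subset: "B \<in> lcosets H \<Longrightarrow> B \<subseteq> carrier G"
  using subgroup.lcosets_carrier[OF subgroup_H is_group] .

lemma lcoset_eq: assumes "B \<in> lcosets H" "u \<in> B" shows "B = u <# H"
proof -
  obtain a where a: "a \<in> carrier G" "B = a <# H"
    using assms(1) by (auto simp: LCOSETS_def)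
  then show ?thesis
    using l_repr_independence[OF _ _ subgroup_H, of u a] assms(2) by simp
qed

lemma lcoset_nonempty: "B \<in> lcosets H \<Longrightarrow> B \<noteq> {}"
  using subgroup_H subgroup.one_closed by (fastforce simp: LCOSETS_def l_coset_eq_image)

lemma H_in_lcosets: "H \<in> lcosets H"
  using lcos_mult_one[OF H_subset] unfolding LCOSETS_def by force

lemma inv_mult_in_H:
  assumes "B \<in> lcosets H" "u \<in> B" "v \<in> B" shows "inv u \<otimes> v \<in> H"
  using subgroup.lcos_module_imp[OF subgroup_H is_group, of u v] lcoset_eq[OF assms(1,2)]
    lcoset_subset assms by blast

lemma disjoint_lcosets: "pairwise disjnt (lcosets H)"
  using lcos_disjoint[OF subgroup_H] by (auto simp: pairwise_def disjnt_def)

lemma clique_l_coset: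
  assumes "g \<in> carrier G" "clique B" shows "clique (g <# B)"
  using assms dist_mult_left unfolding clique_def l_coset_eq_image by (auto simp: subset_iff)

lemma clique_lcoset: "B \<in> lcosets H \<Longrightarrow> clique B"
  using clique_l_coset[OF _ clique_H] by (auto simp: LCOSETS_def)

lemma step_off_l_coset:
  assumes "g \<in> carrier G" "B \<subseteq> carrier G" "(x, y) \<in> step_off B"
  shows "(g \<otimes> x, g \<otimes> y) \<in> step_off (g <# B)"
  using assms dist_mult_left by (auto simp: step_off_def mem_l_coset_iff)

lemma linked_off_l_coset:
  assumes "g \<in> carrier G" "B \<subseteq> carrier G" "(x, y) \<in> linked_off B n"
  shows "(g \<otimes> x, g \<otimes> y) \<in> linked_off (g <# B) n"
proof -
  have "(g \<otimes> x, g \<otimes> y) \<in> step_off (g <# B) ^^ m" if "(x, y) \<in> step_off B ^^ m" for m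
    using that
  proof (induction m arbitrary: y)
    case (Suc m)
    then show ?case
      using step_off_l_coset[OF assms(1,2)] by (metis relpow_Suc_E relpow_Suc_I)
  qed simp
  then show ?thesis
    using assms(3) unfolding linked_off_def by blast
qed

lemma nearest_l_coset:
  assumes "g \<in> carrier G" "B \<subseteq> carrier G" "f \<in> carrier G"
  shows "nearest (g <# B) (g \<otimes> f) = g <# nearest B f"
  using assms dist_mult_left by (auto simp: nearest_def l_coset_eq_image subset_iff)

lemma separated_l_coset_imp:
  assumes "x \<in> carrier G" "B \<subseteq> carrier G" "f \<in> carrier G" "g \<in> carrier G"
    and "separated_by (x <# B) n (x \<otimes> f) (x \<otimes> g)"
  shows "separated_by B n f g"
proof -
  obtain u v where uv: "u \<in> nearest B f" "v \<in> nearest B g"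
      "(x \<otimes> u, x \<otimes> v) \<notin> linked_off (x <# B) n"
    using assms nearest_l_coset by (auto simp: separated_by_def l_coset_eq_image)
  then have "(u, v) \<notin> linked_off B n"
    using linked_off_l_coset[OF assms(1,2)] by blast
  then show ?thesis
    using uv by (auto simp: separated_by_def)
qed

lemma separated_l_coset:
  assumes "x \<in> carrier G" "B \<subseteq> carrier G" "f \<in> carrier G" "g \<in> carrier G"
  shows "separated_by (x <# B) n (x \<otimes> f) (x \<otimes> g) \<longleftrightarrow> separated_by B n f g"
proof
  assume "separated_by B n f g"
  then have "separated_by (inv x <# (x <# B)) n (inv x \<otimes> (x \<otimes> f)) (inv x \<otimes> (x \<otimes> g))"
    using assms by (simp add: l_coset_inv_cancel m_assoc[symmetric])
  then show "separated_by (x <# B) n (x \<otimes> f) (x \<otimes> g)"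
    using separated_l_coset_imp[of "inv x" "x <# B" "x \<otimes> f" "x \<otimes> g" n] assms l_coset_subset_G
    by simp
qed (rule separated_l_coset_imp[OF assms])

lemma linked_in_lcoset:
  assumes B: "B \<in> lcosets H" "u \<in> B" and uv: "v \<in> B" "(u, v) \<in> linked_off B n"
  shows "inv u \<otimes> v \<in> {h \<in> H. (\<one>, h) \<in> linked_off H n}"
proof -
  have u: "u \<in> carrier G"
    using B lcoset_subset by blast
  then have "inv u <# B = H"
    using lcoset_eq[OF B] l_coset_inv_cancel[OF u H_subset] by simp
  then have "(inv u \<otimes> u, inv u \<otimes> v) \<in> linked_off H n"
    using linked_off_l_coset[OF _ lcoset_subset[OF B(1)] uv(2), of "inv u"] u by simp
  then show ?thesis
    using u inv_mult_in_H[OF B uv(1)] by simp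
qed

text \<open>
  No coset separates \<open>f\<close> from itself, so the nearest points are linked to each other, and a point is
  linked to only finitely many others in its coset.
\<close>

lemma finite_nearest:
  assumes B: "B \<in> lcosets H" and f: "f \<in> carrier G" shows "finite (nearest B f)"
proof (cases "nearest B f = {}")
  case False
  then obtain u where u: "u \<in> nearest B f"
    by blast
  then have uB: "u \<in> B" "u \<in> carrier G"
    using lcoset_subset[OF B] nearest_subset by blast+
  have "(\<lambda>v. inv u \<otimes> v) ` nearest B f \<subseteq> {h \<in> H. (\<one>, h) \<in> linked_off H link_bound}"
  proof safe
    fix v assume v: "v \<in> nearest B f"
    have "(u, v) \<in> linked_off B link_bound"
      using not_separated_from_self[OF f clique_lcoset[OF B]] u v unfolding separated_by_def by blast
    then show "inv u \<otimes> v \<in> H" "(\<one>, inv u \<otimes> v) \<in> linked_off H link_bound"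
      using linked_in_lcoset[OF B uB(1)] v nearest_subset by blast+
  qed
  moreover have "inj_on (\<lambda>v. inv u \<otimes> v) (nearest B f)"
    using inj_on_cmult[of "inv u"] uB nearest_subset lcoset_subset[OF B]
    by (blast intro: inj_on_subset)
  ultimately show ?thesis
    by (rule inj_on_finite[rotated, OF _ finite_linked])
qed simp

text \<open>
  The threshold is twice \<^const>\<open>link_bound\<close> because a third point \<open>h\<close> splits it in half: a separator
  of \<open>f\<close> and \<open>g\<close> is crossed by all geodesics from \<open>f\<close> to \<open>h\<close> or by all geodesics from \<open>h\<close> to \<open>g\<close>.
\<close>

definition separators :: "'g \<Rightarrow> 'g \<Rightarrow> 'g set set"
  where "separators f g = {B \<in> lcosets H. separated_by B (2 * link_bound) f g}"

lemma separatorsD: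
  assumes "B \<in> separators f g"
  shows "B \<in> lcosets H" "separated_by B (2 * link_bound) f g" "separated_by B link_bound f g"
  using assms separated_by_mono[of B "2 * link_bound" f g link_bound] by (auto simp: separators_def)

lemma separators_sym: "separators f g = separators g f"
  using separated_by_sym by (auto simp: separators_def)

lemma finite_separators_lcosets:
  assumes "f \<in> carrier G" "g \<in> carrier G" shows "finite (separators f g)"
proof -
  have "separators f g \<subseteq> {B \<in> lcosets H. separated_by B link_bound f g}"
    using separatorsD by blast
  then show ?thesis
    using finite_separators[OF assms clique_lcoset disjoint_lcosets] by (rule finite_subset)
qed

lemma nearest_self: assumes "h \<in> H" shows "nearest H h = {h}"
proof -
  have zero: "d h b = 0 \<longleftrightarrow> b = h" if "b \<in> H" for b
    using dist_eq_0_iff[of h b] that assms H_subset by (auto simp: subset_iff)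
  have "b = h" if "b \<in> nearest H h" for b
  proof -
    have "b \<in> H" "d h b \<le> d h h"
      using that assms by (simp_all add: nearest_def)
    then show ?thesis
      using zero[of b] zero[OF assms] by simp
  qed
  moreover have "h \<in> nearest H h"
    using assms zero[OF assms] by (simp add: nearest_def)
  ultimately show ?thesis
    by blast
qed

text \<open>
  Since \<open>\<one>\<close> and \<open>h\<close> are at distance at most 1, an edge inside a separator must start at \<open>\<one>\<close>.
\<close>

lemma separators_one_H:
  assumes h: "h \<in> H"
  shows "separators \<one> h = (if (\<one>, h) \<in> linked_off H (2 * link_bound) then {} else {H})"
proof -
  have hG: "h \<in> carrier G" "\<one> \<in> H"
    using h H_subset subgroup.one_closed[OF subgroup_H] by auto
  have "B = H" if B: "B \<in> separators \<one> h" for B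
  proof -
    obtain p p' where p: "p \<in> B" "d \<one> p + 1 + d p' h = d \<one> h"
      using geodesics_cross[OF one_closed hG(1) clique_lcoset
          separated_not_geodesic_off[OF one_closed hG(1) clique_lcoset]] separatorsD[OF B] by blast
    have "d \<one> h \<le> 1"
      using cliqueD(2)[OF clique_H hG(2) h] .
    then have "d \<one> p = 0"
      using p(2) by simp
    moreover have "p \<in> carrier G"
      using lcoset_subset[OF separatorsD(1)[OF B]] p(1) by blast
    ultimately have "p = \<one>"
      using dist_eq_0_iff by auto
    then show ?thesis
      using lcoset_eq[OF separatorsD(1)[OF B] p(1)] lcos_mult_one[OF H_subset] by simp
  qed
  moreover have "H \<in> separators \<one> h \<longleftrightarrow> (\<one>, h) \<notin> linked_off H (2 * link_bound)"
    unfolding separators_def separated_by_def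
    using H_in_lcosets nearest_self[OF h] nearest_self[OF hG(2)] by simp
  ultimately show ?thesis
    by auto
qed

end

section \<open>Means in normed modules\<close>

context complex_subfield
begin

lemma emb_zero: "\<iota> 0 = 0"
  using emb_add[of 0 0] by simp

lemma emb_of_nat: "\<iota> (of_nat n) = of_nat n"
  by (induction n) (simp_all add: emb_zero emb_add emb_one)

lemma of_nat_neq_0: "n \<noteq> 0 \<Longrightarrow> (of_nat n :: 'f) \<noteq> 0"
  using emb_of_nat[of n] emb_zero by force

lemma emb_minus_one: "\<iota> (-1) = -1"
  using emb_add[of "-1" 1] emb_one emb_zero by (simp add: eq_neg_iff_add_eq_0)

lemma emb_inverse_of_nat: "n \<noteq> 0 \<Longrightarrow> \<iota> (1 / of_nat n) = 1 / of_nat n"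
  using emb_mult[of "1 / of_nat n" "of_nat n"] of_nat_neq_0[of n]
  by (simp add: emb_of_nat emb_one field_simps)

end

context normed_space_over
begin

lemma nrm_zero [simp]: "nrm 0 = 0"
  by (simp add: nrm_eq_0)

lemma nrm_minus [simp]: "nrm (- v) = nrm v"
  using nrm_scale[of "-1" v] by (simp add: emb_minus_one)

lemma nrm_diff_le: "nrm (v - w) \<le> nrm v + nrm w"
  using nrm_triangle[of v "- w"] by simp

lemma nrm_sum_le: "nrm (sum F A) \<le> (\<Sum>a\<in>A. nrm (F a))"
proof (induction A rule: infinite_finite_induct)
  case (insert a A)
  then show ?case
    using nrm_triangle[of "F a" "sum F A"] by simp
qed simp_all

definition mean :: "'i set \<Rightarrow> ('i \<Rightarrow> 'v) \<Rightarrow> 'v"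
  where "mean A F = scale (1 / of_nat (card A)) (sum F A)"

lemma mean_cong: "(\<And>a. a \<in> A \<Longrightarrow> F a = F' a) \<Longrightarrow> mean A F = mean A F'"
  by (simp add: mean_def)

lemma mean_add: "mean A (\<lambda>a. F a + F' a) = mean A F + mean A F'"
  by (simp add: mean_def sum.distrib scale_right_distrib)

lemma mean_minus: "mean A (\<lambda>a. - F a) = - mean A F"
  by (simp add: mean_def sum_negf)

lemma mean_scale: "mean A (\<lambda>a. scale c (F a)) = scale c (mean A F)"
  by (simp add: mean_def scale_sum_right[symmetric] mult.commute)

lemma mean_const:
  assumes "finite A" "A \<noteq> {}" shows "mean A (\<lambda>_. v) = v"
proof -
  have "(\<Sum>_\<in>A. v) = scale (of_nat (card A)) v"
    by (simp add: sum_constant_scale)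
  then show ?thesis
    using assms of_nat_neq_0[of "card A"] by (simp add: mean_def)
qed

lemma mean_singleton [simp]: "mean {a} F = F a"
  by (simp add: mean_def)

lemma mean_swap: "mean A (\<lambda>a. mean B (F a)) = mean B (\<lambda>b. mean A (\<lambda>a. F a b))"
proof -
  have "(\<Sum>a\<in>A. \<Sum>b\<in>B. F a b) = (\<Sum>b\<in>B. \<Sum>a\<in>A. F a b)"
    by (rule sum.swap)
  then show ?thesis
    by (simp add: mean_def scale_sum_right[symmetric] mult.commute)
qed

lemma nrm_mean_le:
  assumes A: "finite A" "A \<noteq> {}" and M: "\<And>a. a \<in> A \<Longrightarrow> nrm (F a) \<le> M"
  shows "nrm (mean A F) \<le> M"
proof -
  have "nrm (sum F A) \<le> of_nat (card A) * M"
    by (rule order.trans[OF nrm_sum_le sum_bounded_above]) (rule M)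
  moreover have "nrm (mean A F) = nrm (sum F A) / of_nat (card A)"
    using A by (simp add: mean_def nrm_scale emb_inverse_of_nat norm_divide)
  ultimately show ?thesis
    using A by (simp add: divide_le_eq card_gt_0_iff mult.commute)
qed

lemma finite_nrm_bound:
  assumes "finite A" shows "\<exists>M\<ge>0. \<forall>a\<in>A. nrm (F a) \<le> M"
  using member_le_sum[OF _ _ assms, of _ "\<lambda>a. nrm (F a)"] nrm_nonneg
  by (intro exI[of _ "\<Sum>a\<in>A. nrm (F a)"]) (auto intro: sum_nonneg)

end

context normed_group_module
begin

lemma act_hom: "g \<in> carrier G \<Longrightarrow> module_hom scale scale (act g)"
  using act_linear Vector_Spaces.linear.axioms(3) by blast

lemma act_add: "g \<in> carrier G \<Longrightarrow> act g (v + w) = act g v + act g w"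
  using module_hom.add[OF act_hom] .

lemma act_diff: "g \<in> carrier G \<Longrightarrow> act g (v - w) = act g v - act g w"
  using module_hom.diff[OF act_hom] .

lemma act_minus: "g \<in> carrier G \<Longrightarrow> act g (- v) = - act g v"
  using module_hom.neg[OF act_hom] .

lemma act_scale: "g \<in> carrier G \<Longrightarrow> act g (scale c v) = scale c (act g v)"
  using module_hom.scale[OF act_hom] .

lemma act_sum: "g \<in> carrier G \<Longrightarrow> act g (sum F A) = (\<Sum>a\<in>A. act g (F a))"
  using module_hom.sum[OF act_hom] .

lemma act_mean: "g \<in> carrier G \<Longrightarrow> act g (mean A F) = mean A (\<lambda>a. act g (F a))"
  by (simp add: mean_def act_scale act_sum)

lemma act_mult: "g \<in> carrier G \<Longrightarrow> h \<in> carrier G \<Longrightarrow> act (g \<otimes> h) v = act g (act h v)"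
  using composition_rule[of v g h] by simp

lemma act_one: "act \<one> v = v"
  using id_eq_one by (metis UNIV_I restrict_apply')

end

section \<open>The induced quasi-cocycle\<close>

locale induced_quasi_cocycle =
  hyperbolic_coset_geometry G d \<delta> H + normed_group_module G \<iota> scale nrm act
  for G :: "('g, 'b) monoid_scheme" (structure) and d \<delta> H
    and \<iota> :: "'f::field \<Rightarrow> complex" and scale :: "'f \<Rightarrow> 'v::ab_group_add \<Rightarrow> 'v"
    and nrm :: "'v \<Rightarrow> real" and act :: "'g \<Rightarrow> 'v \<Rightarrow> 'v"
begin

text \<open>
  The translate of \<open>\<phi>\<close> to the coset \<open>u <# H\<close>, as a function of two points of the coset.
\<close>

definition increment :: "('g \<Rightarrow> 'v) \<Rightarrow> 'g \<Rightarrow> 'g \<Rightarrow> 'v"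
  where "increment \<phi> u v = act u (\<phi> (inv u \<otimes> v))"

text \<open>
  The mean runs over all nearest points, as a finite subset of \<open>G\<close> may be stabilized by some
  \<open>g \<noteq> \<one>\<close> and then offers no choice of a point that commutes with translations.
\<close>

definition coset_average :: "('g \<Rightarrow> 'v) \<Rightarrow> 'g \<Rightarrow> 'g \<Rightarrow> 'g set \<Rightarrow> 'v"
  where "coset_average \<phi> f g B = mean (nearest B f) (\<lambda>u. mean (nearest B g) (\<lambda>v. increment \<phi> u v))"

definition coset_term :: "('g \<Rightarrow> 'v) \<Rightarrow> 'g \<Rightarrow> 'g \<Rightarrow> 'g set \<Rightarrow> 'v"
  where "coset_term \<phi> f g B = (if B \<in> separators f g then coset_average \<phi> f g B else 0)"

definition induced :: "('g \<Rightarrow> 'v) \<Rightarrow> 'g \<Rightarrow> 'g \<Rightarrow> 'v"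
  where "induced \<phi> f g = (\<Sum>B\<in>separators f g. coset_average \<phi> f g B)"

lemma induced_eq_sum:
  assumes "finite S" "separators f g \<subseteq> S"
  shows "induced \<phi> f g = (\<Sum>B\<in>S. coset_term \<phi> f g B)"
  unfolding induced_def using assms
  by (intro sum.mono_neutral_cong_left) (auto simp: coset_term_def)

lemma nearest_in:
  "B \<in> lcosets H \<Longrightarrow> u \<in> nearest B f \<Longrightarrow> u \<in> B"
  "B \<in> lcosets H \<Longrightarrow> u \<in> nearest B f \<Longrightarrow> u \<in> carrier G"
  using lcoset_subset nearest_subset by blast+

lemma nearest_lcoset_nonempty: "B \<in> lcosets H \<Longrightarrow> nearest B f \<noteq> {}"
  by (rule nearest_nonempty[OF lcoset_nonempty])

lemma coset_average_cong:
  assumes "B \<in> lcosets H" "\<And>h. h \<in> H \<Longrightarrow> \<phi> h = \<psi> h"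
  shows "coset_average \<phi> f g B = coset_average \<psi> f g B"
  unfolding coset_average_def increment_def
  using assms(2)[OF inv_mult_in_H[OF assms(1) nearest_in(1)[OF assms(1)] nearest_in(1)[OF assms(1)]]]
  by (intro mean_cong) simp

lemma induced_cong:
  assumes "\<And>h. h \<in> H \<Longrightarrow> \<phi> h = \<psi> h" shows "induced \<phi> f g = induced \<psi> f g"
  unfolding induced_def using coset_average_cong[OF separatorsD(1) assms] by (intro sum.cong) auto

lemma induced_add:
  assumes "f \<in> carrier G" "g \<in> carrier G"
  shows "induced (\<lambda>h. \<phi> h + \<psi> h) f g = induced \<phi> f g + induced \<psi> f g"
proof -
  have "coset_average (\<lambda>h. \<phi> h + \<psi> h) f g B = coset_average \<phi> f g B + coset_average \<psi> f g B"
    if B: "B \<in> lcosets H" for B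
  proof -
    have "coset_average (\<lambda>h. \<phi> h + \<psi> h) f g B
        = mean (nearest B f) (\<lambda>u. mean (nearest B g) (\<lambda>v. increment \<phi> u v + increment \<psi> u v))"
      unfolding coset_average_def increment_def
      using nearest_in[OF B] by (intro mean_cong) (simp add: act_add)
    then show ?thesis
      by (simp add: coset_average_def mean_add)
  qed
  then show ?thesis
    unfolding induced_def using separatorsD(1) by (simp add: sum.distrib[symmetric])
qed

lemma induced_scale:
  assumes "f \<in> carrier G" "g \<in> carrier G"
  shows "induced (\<lambda>h. scale c (\<phi> h)) f g = scale c (induced \<phi> f g)"
proof -
  have "coset_average (\<lambda>h. scale c (\<phi> h)) f g B = scale c (coset_average \<phi> f g B)"
    if B: "B \<in> lcosets H" for B
  proof -
    have "coset_average (\<lambda>h. scale c (\<phi> h)) f g B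
        = mean (nearest B f) (\<lambda>u. mean (nearest B g) (\<lambda>v. scale c (increment \<phi> u v)))"
      unfolding coset_average_def increment_def
      using nearest_in[OF B] by (intro mean_cong) (simp add: act_scale)
    then show ?thesis
      by (simp add: coset_average_def mean_scale)
  qed
  then show ?thesis
    unfolding induced_def using separatorsD(1) by (simp add: scale_sum_right)
qed

lemma separators_l_coset:
  assumes "x \<in> carrier G" "f \<in> carrier G" "g \<in> carrier G"
  shows "separators (x \<otimes> f) (x \<otimes> g) = (\<lambda>B. x <# B) ` separators f g"
proof
  show "(\<lambda>B. x <# B) ` separators f g \<subseteq> separators (x \<otimes> f) (x \<otimes> g)"
    using assms separated_l_coset lcoset_subset l_coset_in_lcosets by (auto simp: separators_def)
  show "separators (x \<otimes> f) (x \<otimes> g) \<subseteq> (\<lambda>B. x <# B) ` separators f g"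
  proof
    fix B assume B: "B \<in> separators (x \<otimes> f) (x \<otimes> g)"
    have BG: "B \<in> lcosets H" "B \<subseteq> carrier G"
      using separatorsD[OF B] lcoset_subset by blast+
    have eq: "x <# (inv x <# B) = B"
      using l_coset_inv_cancel[of "inv x" B] assms BG by simp
    have "inv x <# B \<in> lcosets H"
      using l_coset_in_lcosets BG assms by simp
    moreover have "separated_by (inv x <# B) (2 * link_bound) f g"
      using separated_l_coset_imp[of x "inv x <# B" f g "2 * link_bound"] assms eq separatorsD(2)[OF B]
        l_coset_subset_G[OF BG(2)] by simp
    ultimately show "B \<in> (\<lambda>B. x <# B) ` separators f g"
      using eq by (force simp: separators_def)
  qed
qed

lemma coset_average_l_coset:
  assumes x: "x \<in> carrier G" and B: "B \<in> lcosets H" and fg: "f \<in> carrier G" "g \<in> carrier G"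
  shows "coset_average \<phi> (x \<otimes> f) (x \<otimes> g) (x <# B) = act x (coset_average \<phi> f g B)"
proof -
  have reindex: "mean (nearest (x <# B) (x \<otimes> f)) F = mean (nearest B f) (\<lambda>u. F (x \<otimes> u))"
    if "f \<in> carrier G" for f and F :: "'g \<Rightarrow> 'v"
  proof -
    have inj: "inj_on (\<lambda>u. x \<otimes> u) (nearest B f)"
      using inj_on_cmult[OF x] nearest_in[OF B] by (auto intro: inj_on_subset)
    moreover have "nearest (x <# B) (x \<otimes> f) = (\<lambda>u. x \<otimes> u) ` nearest B f"
      using nearest_l_coset[OF x lcoset_subset[OF B] that] l_coset_eq_image by simp
    ultimately show ?thesis
      by (simp add: mean_def card_image sum.reindex)
  qed
  have "increment \<phi> (x \<otimes> u) (x \<otimes> v) = act x (increment \<phi> u v)"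
    if "u \<in> nearest B f" "v \<in> nearest B g" for u v
  proof -
    have "u \<in> carrier G" "v \<in> carrier G"
      using that nearest_in[OF B] by auto
    moreover have "inv x \<otimes> (x \<otimes> v) = v"
      using x calculation by (simp add: m_assoc[symmetric])
    then have "inv (x \<otimes> u) \<otimes> (x \<otimes> v) = inv u \<otimes> v"
      using x calculation by (simp add: inv_mult_group m_assoc)
    ultimately show ?thesis
      using x by (simp add: increment_def act_mult)
  qed
  then show ?thesis
    unfolding coset_average_def using fg x
    by (simp add: reindex act_mean cong: mean_cong)
qed

text \<open>
  Translation by \<open>x\<close> permutes the cosets and preserves \<open>d\<close>, hence carries separators to separators
  and nearest points to nearest points.
\<close>

lemma induced_l_mult:
  assumes "x \<in> carrier G" "f \<in> carrier G" "g \<in> carrier G"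
  shows "induced \<phi> (x \<otimes> f) (x \<otimes> g) = act x (induced \<phi> f g)"
proof -
  have "inj_on (\<lambda>B. x <# B) (separators f g)"
    using l_coset_inv_cancel[OF assms(1)] lcoset_subset separatorsD(1) by (metis inj_on_inverseI)
  then have "induced \<phi> (x \<otimes> f) (x \<otimes> g)
      = (\<Sum>B\<in>separators f g. coset_average \<phi> (x \<otimes> f) (x \<otimes> g) (x <# B))"
    by (simp add: induced_def separators_l_coset[OF assms] sum.reindex)
  also have "\<dots> = (\<Sum>B\<in>separators f g. act x (coset_average \<phi> f g B))"
    using assms separatorsD(1) by (intro sum.cong) (auto simp: coset_average_l_coset)
  finally show ?thesis
    using assms by (simp add: induced_def act_sum)
qed

lemma induced_on_H:
  assumes h: "h \<in> H"
  shows "induced \<phi> \<one> h = (if (\<one>, h) \<in> linked_off H (2 * link_bound) then 0 else \<phi> h)"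
proof -
  have "\<one> \<in> H" "h \<in> carrier G"
    using subgroup.one_closed[OF subgroup_H] h H_subset by auto
  then have "coset_average \<phi> \<one> h H = \<phi> h"
    using h by (simp add: coset_average_def nearest_self increment_def mean_const act_one)
  then show ?thesis
    by (simp add: induced_def separators_one_H[OF h])
qed

context
  fixes \<phi> :: "'g \<Rightarrow> 'v" and \<epsilon> M :: real
  assumes quasi: "\<And>h k. h \<in> H \<Longrightarrow> k \<in> H \<Longrightarrow> nrm (\<phi> (h \<otimes> k) - \<phi> h - act h (\<phi> k)) \<le> \<epsilon>"
    and antisym: "\<And>h. h \<in> H \<Longrightarrow> \<phi> (inv h) = - act (inv h) (\<phi> h)"
    and bound: "\<And>h. h \<in> H \<Longrightarrow> (\<one>, h) \<in> linked_off H (2 * link_bound) \<Longrightarrow> nrm (\<phi> h) \<le> M"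
    and M_nonneg: "0 \<le> M"
begin

lemma increment_swap:
  assumes B: "B \<in> lcosets H" and uv: "u \<in> B" "v \<in> B"
  shows "increment \<phi> v u = - increment \<phi> u v"
proof -
  define h where "h = inv u \<otimes> v"
  have G: "u \<in> carrier G" "v \<in> carrier G"
    using lcoset_subset[OF B] uv by auto
  have h: "h \<in> H" "h \<in> carrier G"
    using inv_mult_in_H[OF B uv] H_subset by (auto simp: h_def)
  have inv_h: "inv v \<otimes> u = inv h"
    using G by (simp add: h_def inv_mult_group)
  have "v \<otimes> inv h = u"
    using G by (simp add: inv_h[symmetric] m_assoc[symmetric])
  have "increment \<phi> v u = act v (- act (inv h) (\<phi> h))"
    using antisym[OF h(1)] by (simp add: increment_def inv_h)
  also have "\<dots> = - act (v \<otimes> inv h) (\<phi> h)"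
    using G h by (simp add: act_minus act_mult)
  also have "v \<otimes> inv h = u"
    by fact
  finally show ?thesis
    by (simp add: increment_def h_def)
qed

text \<open>
  Up to translation by \<open>u\<close> and sign this is the defect of \<open>\<phi>\<close> at \<open>u\<^sup>-\<^sup>1 v\<close> and \<open>v\<^sup>-\<^sup>1 w\<close>.
\<close>

lemma nrm_increment_triangle:
  assumes B: "B \<in> lcosets H" and uvw: "u \<in> B" "v \<in> B" "w \<in> B"
  shows "nrm (increment \<phi> u v + increment \<phi> v w + increment \<phi> w u) \<le> \<epsilon>"
proof -
  define h k where "h = inv u \<otimes> v" and "k = inv v \<otimes> w"
  have G: "u \<in> carrier G" "v \<in> carrier G" "w \<in> carrier G"
    using lcoset_subset[OF B] uvw by auto
  have H: "h \<in> H" "k \<in> H" "h \<in> carrier G" "k \<in> carrier G"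
    using inv_mult_in_H[OF B] uvw H_subset by (auto simp: h_def k_def)
  have uh: "u \<otimes> h = v"
    using G by (simp add: h_def m_assoc[symmetric])
  have "v \<otimes> (inv v \<otimes> w) = w"
    using G by (simp add: m_assoc[symmetric])
  then have hk: "h \<otimes> k = inv u \<otimes> w"
    using G by (simp add: h_def k_def m_assoc)
  have "increment \<phi> v w = act u (act h (\<phi> k))"
    using G H uh by (simp add: increment_def k_def[symmetric] act_mult[symmetric])
  moreover have "increment \<phi> w u = - act u (\<phi> (h \<otimes> k))"
    using increment_swap[OF B uvw(1,3)] by (simp add: increment_def hk)
  moreover have "increment \<phi> u v = act u (\<phi> h)"
    by (simp add: increment_def h_def)
  ultimately have "increment \<phi> u v + increment \<phi> v w + increment \<phi> w u
      = - act u (\<phi> (h \<otimes> k) - \<phi> h - act h (\<phi> k))"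
    using G by (simp add: act_diff)
  then show ?thesis
    using quasi[OF H(1,2)] G by (simp add: act_isometry)
qed

lemma coset_average_swap:
  assumes B: "B \<in> lcosets H"
  shows "coset_average \<phi> g f B = - coset_average \<phi> f g B"
proof -
  have "coset_average \<phi> g f B = mean (nearest B f) (\<lambda>u. mean (nearest B g) (\<lambda>v. increment \<phi> v u))"
    unfolding coset_average_def by (rule mean_swap)
  also have "\<dots> = mean (nearest B f) (\<lambda>u. mean (nearest B g) (\<lambda>v. - increment \<phi> u v))"
    using increment_swap[OF B nearest_in(1)[OF B] nearest_in(1)[OF B]] by (intro mean_cong)
  finally show ?thesis
    by (simp add: coset_average_def mean_minus)
qed

lemma coset_term_swap: "coset_term \<phi> g f B = - coset_term \<phi> f g B"
  using coset_average_swap[of B g f] separators_sym[of f g] separatorsD(1)[of B f g]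
  by (simp add: coset_term_def)

text \<open>
  All three averages become means over the same triples \<open>(u, v, w)\<close>, one point for each corner.
\<close>

lemma nrm_coset_average_triangle:
  assumes B: "B \<in> lcosets H" and G: "f \<in> carrier G" "g \<in> carrier G" "h \<in> carrier G"
  shows "nrm (coset_average \<phi> f g B + coset_average \<phi> g h B + coset_average \<phi> h f B) \<le> \<epsilon>"
proof -
  let ?P = "nearest B f" and ?Q = "nearest B g" and ?R = "nearest B h"
  let ?i = "increment \<phi>"
  have fin: "finite ?P" "finite ?Q" "finite ?R"
    using finite_nearest[OF B] G by auto
  have ne: "?P \<noteq> {}" "?Q \<noteq> {}" "?R \<noteq> {}"
    using nearest_lcoset_nonempty[OF B] by auto
  have "coset_average \<phi> f g B = mean ?P (\<lambda>u. mean ?Q (\<lambda>v. mean ?R (\<lambda>w. ?i u v)))"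
    by (simp add: coset_average_def mean_const[OF fin(3) ne(3)])
  moreover have "coset_average \<phi> g h B = mean ?P (\<lambda>u. mean ?Q (\<lambda>v. mean ?R (\<lambda>w. ?i v w)))"
    by (simp add: coset_average_def mean_const[OF fin(1) ne(1)])
  moreover have "coset_average \<phi> h f B = mean ?P (\<lambda>u. mean ?R (\<lambda>w. ?i w u))"
    unfolding coset_average_def by (rule mean_swap)
  then have "coset_average \<phi> h f B = mean ?P (\<lambda>u. mean ?Q (\<lambda>v. mean ?R (\<lambda>w. ?i w u)))"
    by (simp add: mean_const[OF fin(2) ne(2)])
  ultimately have "coset_average \<phi> f g B + coset_average \<phi> g h B + coset_average \<phi> h f B
      = mean ?P (\<lambda>u. mean ?Q (\<lambda>v. mean ?R (\<lambda>w. ?i u v + ?i v w + ?i w u)))"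
    by (simp add: mean_add)
  moreover have "nrm \<dots> \<le> \<epsilon>"
    using nearest_in(1)[OF B]
    by (intro nrm_mean_le fin ne nrm_increment_triangle[OF B]) auto
  ultimately show ?thesis
    by simp
qed

text \<open>
  Below the threshold the increments are values of \<open>\<phi>\<close> on the finite set on which it is bounded by
  \<open>M\<close>, so cutting off the non-separating cosets costs little.
\<close>

lemma nrm_coset_average_le:
  assumes B: "B \<in> lcosets H" "B \<notin> separators f g" and G: "f \<in> carrier G" "g \<in> carrier G"
  shows "nrm (coset_average \<phi> f g B) \<le> M"
proof -
  have "nrm (increment \<phi> u v) \<le> M" if uv: "u \<in> nearest B f" "v \<in> nearest B g" for u v
  proof -
    have "(u, v) \<in> linked_off B (2 * link_bound)"
      using B uv by (auto simp: separators_def separated_by_def)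
    then have "nrm (\<phi> (inv u \<otimes> v)) \<le> M"
      using linked_in_lcoset[OF B(1)] nearest_in(1)[OF B(1)] uv bound by blast
    then show ?thesis
      using nearest_in(2)[OF B(1)] uv by (simp add: increment_def act_isometry)
  qed
  then show ?thesis
    unfolding coset_average_def
    by (intro nrm_mean_le finite_nearest nearest_lcoset_nonempty B G)
qed

definition triangle_term :: "'g \<Rightarrow> 'g \<Rightarrow> 'g \<Rightarrow> 'g set \<Rightarrow> 'v"
  where "triangle_term f g h B = coset_term \<phi> f g B + coset_term \<phi> g h B + coset_term \<phi> h f B"

lemma triangle_term_rotate: "triangle_term f g h B = triangle_term g h f B"
  by (simp add: triangle_term_def add_ac)

lemma triangle_term_swap: "triangle_term g f h B = - triangle_term f g h B"
  using coset_term_swap[of g f B] coset_term_swap[of f h B] coset_term_swap[of h g B]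
  by (simp add: triangle_term_def)

lemma nrm_triangle_term_le:
  assumes B: "B \<in> lcosets H" and G: "f \<in> carrier G" "g \<in> carrier G" "h \<in> carrier G"
  shows "nrm (triangle_term f g h B) \<le> \<epsilon> + 3 * M"
proof -
  have *: "nrm (coset_term \<phi> x y B - coset_average \<phi> x y B) \<le> M"
    if "x \<in> carrier G" "y \<in> carrier G" for x y
    using nrm_coset_average_le[OF B _ that] M_nonneg by (simp add: coset_term_def)
  let ?D = "\<lambda>x y. coset_term \<phi> x y B - coset_average \<phi> x y B"
  let ?A = "coset_average \<phi> f g B + coset_average \<phi> g h B + coset_average \<phi> h f B"
  have eq: "triangle_term f g h B = ?A + (?D f g + (?D g h + ?D h f))"
    by (simp add: triangle_term_def)
  have "nrm (?A + (?D f g + (?D g h + ?D h f))) \<le> nrm ?A + nrm (?D f g + (?D g h + ?D h f))"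
    by (rule nrm_triangle)
  moreover have "nrm (?D f g + (?D g h + ?D h f)) \<le> nrm (?D f g) + nrm (?D g h + ?D h f)"
    by (rule nrm_triangle)
  moreover have "nrm (?D g h + ?D h f) \<le> nrm (?D g h) + nrm (?D h f)"
    by (rule nrm_triangle)
  ultimately show ?thesis
    unfolding eq using nrm_coset_average_triangle[OF B G] *[OF G(1,2)] *[OF G(2,3)] *[OF G(3,1)]
    by linarith
qed

text \<open>
  Seen from \<open>B\<close>, the corners \<open>g\<close> and \<open>h\<close> coincide: the terms for \<open>(f, g)\<close> and \<open>(h, f)\<close> cancel, and
  \<open>B\<close> does not separate \<open>g\<close> from \<open>h\<close>.
\<close>

lemma triangle_term_eq_0:
  assumes B: "B \<in> lcosets H" and g: "g \<in> carrier G" and eq: "nearest B g = nearest B h"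
  shows "triangle_term f g h B = 0"
proof -
  have "coset_term \<phi> f h B = coset_term \<phi> f g B"
    using B eq by (simp add: coset_term_def separators_def coset_average_def separated_by_def)
  moreover have "\<not> separated_by B link_bound g h"
    using not_separated_from_self[OF g clique_lcoset[OF B]] by (simp add: separated_by_def eq)
  then have "coset_term \<phi> g h B = 0"
    using separatorsD(3) by (auto simp: coset_term_def)
  ultimately show ?thesis
    by (simp add: triangle_term_def coset_term_swap[of h f])
qed

definition contributing :: "'g \<Rightarrow> 'g \<Rightarrow> 'g \<Rightarrow> 'g set set"
  where "contributing f g h = {B \<in> separators f g. triangle_term f g h B \<noteq> 0}"

text \<open>
  Of two cosets separating \<open>f\<close> from both \<open>g\<close> and \<open>h\<close>, the one met first from \<open>f\<close> has the same
  nearest points to \<open>g\<close> and to \<open>h\<close>, so it does not contribute.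
\<close>

lemma contributing_unique:
  assumes G: "f \<in> carrier G" "g \<in> carrier G" "h \<in> carrier G"
    and B: "B \<in> contributing f g h" "separated_by B link_bound f h"
    and B0: "B0 \<in> contributing f g h" "separated_by B0 link_bound f h"
  shows "B = B0"
proof (rule ccontr)
  assume neq: "B \<noteq> B0"
  have S: "B \<in> separators f g" "B0 \<in> separators f g"
    using B B0 by (auto simp: contributing_def)
  note L = separatorsD(1)[OF S(1)] separatorsD(1)[OF S(2)]
  note clq = clique_lcoset[OF L(1)] clique_lcoset[OF L(2)]
  note sep = separatorsD(3)[OF S(1)] separatorsD(3)[OF S(2)]
  have disj: "B \<inter> B0 = {}"
    using disjoint_lcosets L neq by (auto simp: pairwise_def disjnt_def)
  obtain u u0 where u: "u \<in> nearest B f" "u0 \<in> nearest B0 f"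
    using nearest_lcoset_nonempty L by blast
  have "d f u \<noteq> d f u0"
    using disjoint_separators_dist_neq[OF G(1,2) clq disj sep u] .
  then consider "d f u < d f u0" | "d f u0 < d f u"
    by linarith
  then have "nearest B g = nearest B h \<or> nearest B0 g = nearest B0 h"
  proof cases
    case 1
    then show ?thesis
      using nearest_eq_if_later_separator[OF G clq sep B(2) B0(2) u 1] by simp
  next
    case 2
    then show ?thesis
      using nearest_eq_if_later_separator[OF G clq(2,1) sep(2,1) B0(2) B(2) u(2,1) 2] by simp
  qed
  then show False
    using triangle_term_eq_0[OF L(1) G(2)] triangle_term_eq_0[OF L(2) G(2)] B(1) B0(1)
    by (auto simp: contributing_def)
qed

text \<open>
  A separator of \<open>f\<close> and \<open>g\<close> is met on the way from \<open>f\<close> to \<open>h\<close> or on the way from \<open>g\<close> to \<open>h\<close>, and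
  \<open>contributing_unique\<close> applies at the corner \<open>f\<close> or at the corner \<open>g\<close>.
\<close>

lemma card_contributing_le:
  assumes G: "f \<in> carrier G" "g \<in> carrier G" "h \<in> carrier G"
  shows "finite (contributing f g h) \<and> card (contributing f g h) \<le> 2"
proof -
  let ?A = "{B \<in> contributing f g h. separated_by B link_bound f h}"
  let ?B = "{B \<in> contributing g f h. separated_by B link_bound g h}"
  have "finite ?A \<and> card ?A \<le> 1" "finite ?B \<and> card ?B \<le> 1"
    using contributing_unique[OF G] contributing_unique[OF G(2,1,3)]
    by (intro card_le_1_if_unique; blast)+
  then have fin: "finite (?A \<union> ?B)" and card: "card (?A \<union> ?B) \<le> 2"
    using card_Un_le[of ?A ?B] by (blast, linarith)
  have sub: "contributing f g h \<subseteq> ?A \<union> ?B"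
  proof
    fix B assume B: "B \<in> contributing f g h"
    then have S: "B \<in> separators f g"
      by (simp add: contributing_def)
    have "separated_by B (link_bound + link_bound) f g"
      using separatorsD(2)[OF S] by (simp add: mult_2)
    then have "separated_by B link_bound f h \<or> separated_by B link_bound g h"
      using separated_triangle[of B link_bound link_bound f g h] separated_by_sym
        nearest_lcoset_nonempty[OF separatorsD(1)[OF S]] by blast
    moreover have "B \<in> contributing g f h"
      using B separators_sym[of f g] by (simp add: contributing_def triangle_term_swap[of g f])
    ultimately show "B \<in> ?A \<union> ?B"
      using B by blast
  qed
  show ?thesis
    using finite_subset[OF sub fin] card_mono[OF fin sub] card by simp
qed

lemma nrm_induced_triangle_le:
  assumes G: "f \<in> carrier G" "g \<in> carrier G" "h \<in> carrier G"
  shows "nrm (induced \<phi> f g + induced \<phi> g h + induced \<phi> h f) \<le> 6 * (\<epsilon> + 3 * M)"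
proof -
  define S where "S = separators f g \<union> separators g h \<union> separators h f"
  define N where "N = contributing f g h \<union> contributing g h f \<union> contributing h f g"
  have S: "finite S"
    using finite_separators_lcosets G by (simp add: S_def)
  have "induced \<phi> f g + induced \<phi> g h + induced \<phi> h f = (\<Sum>B\<in>S. triangle_term f g h B)"
  proof -
    have "separators f g \<subseteq> S" "separators g h \<subseteq> S" "separators h f \<subseteq> S"
      by (auto simp: S_def)
    then show ?thesis
      by (simp add: induced_eq_sum[OF S] triangle_term_def sum.distrib)
  qed
  also have "\<dots> = (\<Sum>B\<in>N. triangle_term f g h B)"
  proof (rule sum.mono_neutral_right[OF S])
    show "N \<subseteq> S"
      by (auto simp: N_def S_def contributing_def)
    show "\<forall>B\<in>S - N. triangle_term f g h B = 0"
      using triangle_term_rotate[of f g h] triangle_term_rotate[of g h f]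
      by (auto simp: N_def S_def contributing_def)
  qed
  finally have eq: "induced \<phi> f g + induced \<phi> g h + induced \<phi> h f = (\<Sum>B\<in>N. triangle_term f g h B)" .
  have "card N \<le> 6"
    using card_contributing_le[OF G] card_contributing_le[OF G(2,3,1)] card_contributing_le[OF G(3,1,2)]
      card_Un_le[of "contributing f g h \<union> contributing g h f" "contributing h f g"]
      card_Un_le[of "contributing f g h" "contributing g h f"]
    unfolding N_def by linarith
  have "nrm (triangle_term f g h B) \<le> \<epsilon> + 3 * M" if "B \<in> N" for B
    using that separatorsD(1) by (intro nrm_triangle_term_le G) (auto simp: N_def contributing_def)
  then have "(\<Sum>B\<in>N. nrm (triangle_term f g h B)) \<le> real (card N) * (\<epsilon> + 3 * M)"
    by (rule sum_bounded_above)
  moreover have "0 \<le> \<epsilon>"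
    using quasi[OF subgroup.one_closed[OF subgroup_H] subgroup.one_closed[OF subgroup_H]]
      nrm_nonneg order.trans by blast
  then have "real (card N) * (\<epsilon> + 3 * M) \<le> 6 * (\<epsilon> + 3 * M)"
    using \<open>card N \<le> 6\<close> M_nonneg by (intro mult_right_mono) auto
  ultimately show ?thesis
    unfolding eq using nrm_sum_le[of "triangle_term f g h" N] by linarith
qed

lemma induced_swap: "induced \<phi> g f = - induced \<phi> f g"
proof -
  have "induced \<phi> g f = (\<Sum>B\<in>separators f g. coset_average \<phi> g f B)"
    by (simp add: induced_def separators_sym[of g f])
  also have "\<dots> = (\<Sum>B\<in>separators f g. - coset_average \<phi> f g B)"
    by (intro sum.cong refl coset_average_swap) (rule separatorsD(1))
  finally show ?thesis
    by (simp add: induced_def sum_negf)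
qed

text \<open>
  By equivariance \<open>f \<cdot> r(1, g) = r(f, f g)\<close>, and the defect is the sum around the triangle
  \<open>1, f, f g\<close>.
\<close>

lemma nrm_induced_coboundary_le:
  assumes G: "f \<in> carrier G" "g \<in> carrier G"
  shows "nrm (induced \<phi> \<one> (f \<otimes> g) - induced \<phi> \<one> f - act f (induced \<phi> \<one> g)) \<le> 6 * (\<epsilon> + 3 * M)"
proof -
  have "act f (induced \<phi> \<one> g) = induced \<phi> f (f \<otimes> g)"
    using induced_l_mult[OF G(1) one_closed G(2)] G by simp
  then have eq: "induced \<phi> \<one> (f \<otimes> g) - induced \<phi> \<one> f - act f (induced \<phi> \<one> g)
      = - (induced \<phi> \<one> f + induced \<phi> f (f \<otimes> g) + induced \<phi> (f \<otimes> g) \<one>)"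
    using induced_swap[of "f \<otimes> g" \<one>] by simp
  show ?thesis
    unfolding eq nrm_minus using nrm_induced_triangle_le[of \<one> f "f \<otimes> g"] G by simp
qed

end

definition antisymmetrized :: "('g \<Rightarrow> 'v) \<Rightarrow> 'g \<Rightarrow> 'v"
  where "antisymmetrized q h = scale (1 / 2) (q h - act h (q (inv h)))"

lemma two_neq_0: "(2 :: 'f) \<noteq> 0"
  using of_nat_neq_0[of 2] by simp

lemma nrm_half: "nrm (scale (1 / 2) v) = nrm v / 2"
proof -
  have "\<iota> (1 / of_nat 2) = 1 / of_nat 2"
    by (rule emb_inverse_of_nat) simp
  then have "\<iota> (1 / 2) = 1 / 2"
    by (simp only: of_nat_numeral)
  then have "cmod (\<iota> (1 / 2)) = 1 / 2"
    by (simp only: norm_divide norm_one norm_numeral)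
  then show ?thesis
    by (simp add: nrm_scale)
qed

lemma H_closed: "h \<in> H \<Longrightarrow> h \<in> carrier G" "h \<in> H \<Longrightarrow> inv h \<in> H" "\<one> \<in> H"
    "h \<in> H \<Longrightarrow> k \<in> H \<Longrightarrow> h \<otimes> k \<in> H"
  using H_subset subgroup_H by (auto intro: subgroup.m_inv_closed subgroup.one_closed subgroup.m_closed)

lemma antisymmetrized_inv:
  assumes h: "h \<in> H"
  shows "antisymmetrized q (inv h) = - act (inv h) (antisymmetrized q h)"
proof -
  have hG: "h \<in> carrier G" "inv h \<in> carrier G"
    using H_closed h by auto
  have "act (inv h) (act h (q (inv h))) = q (inv h)"
    using act_mult[OF hG(2,1), of "q (inv h)"] hG by (simp add: act_one)
  then show ?thesis
    using hG by (simp add: antisymmetrized_def act_scale act_diff scale_right_diff_distrib)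
qed

lemma QZ1_H_iff:
  "q \<in> QZ1 act nrm (G\<lparr>carrier := H\<rparr>) U \<longleftrightarrow> q \<in> H \<rightarrow>\<^sub>E U \<and>
    (\<exists>\<epsilon>>0. \<forall>h\<in>H. \<forall>k\<in>H. nrm (q (h \<otimes> k) - q h - act h (q k)) \<le> \<epsilon>)"
  by (simp add: QZ1_def)

text \<open>
  The defect at \<open>(h, h\<^sup>-\<^sup>1)\<close> compares \<open>q h\<close> with \<open>- h \<cdot> q (h\<^sup>-\<^sup>1)\<close> up to \<open>q \<one>\<close>, which is itself
  bounded by the defect at \<open>(\<one>, \<one>)\<close>.
\<close>

lemma antisymmetrized_near:
  assumes qc: "\<forall>h\<in>H. \<forall>k\<in>H. nrm (q (h \<otimes> k) - q h - act h (q k)) \<le> \<epsilon>" and h: "h \<in> H"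
  shows "nrm (antisymmetrized q h - q h) \<le> \<epsilon>"
proof -
  let ?x = "q \<one> - q h - act h (q (inv h))"
  have hG: "h \<in> carrier G"
    using H_closed h by auto
  have x: "nrm ?x \<le> \<epsilon>"
    using qc h H_closed(2)[OF h] hG by force
  have "nrm (q (\<one> \<otimes> \<one>) - q \<one> - act \<one> (q \<one>)) \<le> \<epsilon>"
    using qc H_closed(3) by blast
  then have one: "nrm (q \<one>) \<le> \<epsilon>"
    by (simp add: act_one)
  have "q h = scale (1 / 2) (q h + q h)"
    using two_neq_0 by (simp add: scale_left_distrib[symmetric] scale_right_distrib)
  then have "antisymmetrized q h - q h = scale (1 / 2) ((q h - act h (q (inv h))) - (q h + q h))"
    unfolding antisymmetrized_def scale_right_diff_distrib[of _ _ "q h + q h"] by simp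
  also have "(q h - act h (q (inv h))) - (q h + q h) = ?x - q \<one>"
    by simp
  finally have "nrm (antisymmetrized q h - q h) = nrm (?x - q \<one>) / 2"
    by (simp only: nrm_half)
  then show ?thesis
    using nrm_diff_le[of ?x "q \<one>"] x one by linarith
qed

lemma antisymmetrized_quasi:
  assumes qc: "\<forall>h\<in>H. \<forall>k\<in>H. nrm (q (h \<otimes> k) - q h - act h (q k)) \<le> \<epsilon>" and H: "h \<in> H" "k \<in> H"
  shows "nrm (antisymmetrized q (h \<otimes> k) - antisymmetrized q h - act h (antisymmetrized q k)) \<le> 4 * \<epsilon>"
proof -
  let ?e = "\<lambda>h. antisymmetrized q h - q h"
  have eq: "antisymmetrized q (h \<otimes> k) - antisymmetrized q h - act h (antisymmetrized q k)
      = (q (h \<otimes> k) - q h - act h (q k)) + ((?e (h \<otimes> k) - ?e h) - act h (?e k))"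
    using H_closed(1)[OF H(1)] by (simp add: act_diff)
  have "nrm ((?e (h \<otimes> k) - ?e h) - act h (?e k)) \<le> nrm (?e (h \<otimes> k)) + nrm (?e h) + nrm (?e k)"
    using nrm_diff_le[of "?e (h \<otimes> k) - ?e h" "act h (?e k)"] nrm_diff_le[of "?e (h \<otimes> k)" "?e h"]
      act_isometry[OF H_closed(1)[OF H(1)], of "?e k"] by linarith
  moreover have "nrm (q (h \<otimes> k) - q h - act h (q k)) \<le> \<epsilon>"
    using qc H by blast
  ultimately show ?thesis
    unfolding eq
    using nrm_triangle[of "q (h \<otimes> k) - q h - act h (q k)" "(?e (h \<otimes> k) - ?e h) - act h (?e k)"]
      antisymmetrized_near[OF qc H(1)] antisymmetrized_near[OF qc H(2)]
      antisymmetrized_near[OF qc H_closed(4)[OF H]] by linarith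
qed

definition extension :: "('g \<Rightarrow> 'v) \<Rightarrow> 'g \<Rightarrow> 'v"
  where "extension q = (\<lambda>g\<in>carrier G. induced (antisymmetrized q) \<one> g)"

lemma extension_in_QZ1:
  assumes q: "q \<in> QZ1 act nrm (G\<lparr>carrier := H\<rparr>) U"
  shows "extension q \<in> QZ1 act nrm G UNIV"
proof -
  obtain \<epsilon> where \<epsilon>: "\<epsilon> > 0" and qc: "\<forall>h\<in>H. \<forall>k\<in>H. nrm (q (h \<otimes> k) - q h - act h (q k)) \<le> \<epsilon>"
    using q by (auto simp: QZ1_H_iff)
  obtain M where M: "M \<ge> 0"
      "\<forall>h\<in>{h \<in> H. (\<one>, h) \<in> linked_off H (2 * link_bound)}. nrm (antisymmetrized q h) \<le> M"
    using finite_nrm_bound[OF finite_linked] by blast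
  have "nrm (induced (antisymmetrized q) \<one> (f \<otimes> g) - induced (antisymmetrized q) \<one> f
      - act f (induced (antisymmetrized q) \<one> g)) \<le> 6 * (4 * \<epsilon> + 3 * M)"
    if "f \<in> carrier G" "g \<in> carrier G" for f g
    using antisymmetrized_quasi[OF qc] antisymmetrized_inv M that
    by (intro nrm_induced_coboundary_le) auto
  moreover have "6 * (4 * \<epsilon> + 3 * M) > 0"
    using \<epsilon> M by simp
  ultimately show ?thesis
    unfolding QZ1_def extension_def by auto
qed

lemma extension_add:
  "extension (\<lambda>h\<in>H. q h + r h) = (\<lambda>g\<in>carrier G. extension q g + extension r g)"
proof -
  have "induced (antisymmetrized (\<lambda>h\<in>H. q h + r h)) \<one> g
      = induced (antisymmetrized q) \<one> g + induced (antisymmetrized r) \<one> g" if "g \<in> carrier G" for g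
  proof -
    have "antisymmetrized (\<lambda>h\<in>H. q h + r h) h = antisymmetrized q h + antisymmetrized r h"
      if "h \<in> H" for h
      using that H_closed
      by (simp add: antisymmetrized_def act_add scale_right_distrib scale_right_diff_distrib)
    then have "induced (antisymmetrized (\<lambda>h\<in>H. q h + r h)) \<one> g
        = induced (\<lambda>h. antisymmetrized q h + antisymmetrized r h) \<one> g"
      by (rule induced_cong)
    then show ?thesis
      by (simp only: induced_add[OF one_closed that])
  qed
  then show ?thesis
    by (auto simp: extension_def)
qed

lemma extension_scale:
  "extension (\<lambda>h\<in>H. scale a (q h)) = (\<lambda>g\<in>carrier G. scale a (extension q g))"
proof -
  have "induced (antisymmetrized (\<lambda>h\<in>H. scale a (q h))) \<one> g
      = scale a (induced (antisymmetrized q) \<one> g)" if "g \<in> carrier G" for g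
  proof -
    have "antisymmetrized (\<lambda>h\<in>H. scale a (q h)) h = scale a (antisymmetrized q h)"
      if "h \<in> H" for h
      using that H_closed
      by (simp add: antisymmetrized_def act_scale scale_right_diff_distrib mult.commute)
    then have "induced (antisymmetrized (\<lambda>h\<in>H. scale a (q h))) \<one> g
        = induced (\<lambda>h. scale a (antisymmetrized q h)) \<one> g"
      by (rule induced_cong)
    then show ?thesis
      by (simp only: induced_scale[OF one_closed that])
  qed
  then show ?thesis
    by (auto simp: extension_def)
qed

lemma extension_on_H:
  assumes "h \<in> H"
  shows "extension q h = (if (\<one>, h) \<in> linked_off H (2 * link_bound) then 0 else antisymmetrized q h)"
  using assms H_closed(1) by (simp add: extension_def induced_on_H)

lemma extension_near:
  assumes q: "q \<in> QZ1 act nrm (G\<lparr>carrier := H\<rparr>) U"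
  shows "bdd_above ((\<lambda>h. nrm (extension q h - q h)) ` H)"
proof -
  obtain \<epsilon> where \<epsilon>: "\<epsilon> > 0" and qc: "\<forall>h\<in>H. \<forall>k\<in>H. nrm (q (h \<otimes> k) - q h - act h (q k)) \<le> \<epsilon>"
    using q by (auto simp: QZ1_H_iff)
  obtain M where M: "M \<ge> 0"
      "\<forall>h\<in>{h \<in> H. (\<one>, h) \<in> linked_off H (2 * link_bound)}. nrm (q h) \<le> M"
    using finite_nrm_bound[OF finite_linked] by blast
  show ?thesis
  proof (rule bdd_aboveI2)
    fix h assume h: "h \<in> H"
    then show "nrm (extension q h - q h) \<le> \<epsilon> + M"
      using antisymmetrized_near[OF qc h] M \<epsilon>
      by (auto simp: extension_on_H intro: add_increasing add_increasing2)
  qed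
qed

lemma restrict_extension_in_QZ1:
  assumes q: "q \<in> QZ1 act nrm (G\<lparr>carrier := H\<rparr>) U" and U: "group_submodule scale act H U"
  shows "restrict (extension q) H \<in> QZ1 act nrm (G\<lparr>carrier := H\<rparr>) U"
proof -
  have sub: "subspace U" and inv: "\<forall>h\<in>H. \<forall>u\<in>U. act h u \<in> U"
    using U by (auto simp: group_submodule_def)
  have "extension q h \<in> U" if h: "h \<in> H" for h
  proof -
    have "q h \<in> U" "q (inv h) \<in> U"
      using q h H_closed(2) by (auto simp: QZ1_H_iff)
    then have "antisymmetrized q h \<in> U"
      using sub inv h by (auto simp: antisymmetrized_def intro: subspace_scale subspace_diff)
    then show ?thesis
      using h subspace_0[OF sub] by (simp add: extension_on_H)
  qed
  moreover obtain \<epsilon> where "\<epsilon> > 0" "\<forall>f\<in>carrier G. \<forall>g\<in>carrier G.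
      nrm (extension q (f \<otimes> g) - extension q f - act f (extension q g)) \<le> \<epsilon>"
    using extension_in_QZ1[OF q] by (auto simp: QZ1_def)
  then have "\<forall>h\<in>H. \<forall>k\<in>H. nrm (extension q (h \<otimes> k) - extension q h - act h (extension q k)) \<le> \<epsilon>" "\<epsilon> > 0"
    using H_closed(1) by blast+
  ultimately show ?thesis
    unfolding QZ1_H_iff using H_closed(4) by (auto intro!: exI[of _ \<epsilon>])
qed

end

section \<open>Cayley graphs relative to a subgroup\<close>

text \<open>
  Powers of this relation replace walks, which makes reversal and translation of walks immediate.
\<close>

definition arc_rel :: "('a, 'e) pre_digraph \<Rightarrow> 'e set \<Rightarrow> 'a rel"
  where "arc_rel D A = {(tail D e, head D e) | e. e \<in> arcs D - A}"

lemma (in wf_digraph) awalk_iff_relpow: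
  assumes "u \<in> verts G"
  shows "(\<exists>p. awalk u p v \<and> set p \<inter> A = {} \<and> length p = n) \<longleftrightarrow> (u, v) \<in> arc_rel G A ^^ n"
  using assms
proof (induction n arbitrary: u)
  case 0
  then show ?case by (auto simp: awalk_Nil_iff)
next
  case (Suc n)
  have "(\<exists>p. awalk u p v \<and> set p \<inter> A = {} \<and> length p = Suc n) \<longleftrightarrow>
      (\<exists>e es. awalk u (e # es) v \<and> set (e # es) \<inter> A = {} \<and> length es = n)"
    by (metis length_Suc_conv)
  also have "\<dots> \<longleftrightarrow> (\<exists>e\<in>arcs G - A. tail G e = u \<and>
      (\<exists>es. awalk (head G e) es v \<and> set es \<inter> A = {} \<and> length es = n))"
    by (simp add: awalk_Cons_iff) blast
  also have "\<dots> \<longleftrightarrow> (\<exists>e\<in>arcs G - A. tail G e = u \<and> (head G e, v) \<in> arc_rel G A ^^ n)"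
    using Suc.IH by (intro bex_cong refl conj_cong) auto
  also have "\<dots> \<longleftrightarrow> (\<exists>w. (u, w) \<in> arc_rel G A \<and> (w, v) \<in> arc_rel G A ^^ n)"
    by (auto simp: arc_rel_def)
  also have "\<dots> \<longleftrightarrow> (u, v) \<in> arc_rel G A ^^ Suc n"
    by (meson relpow_Suc_D2 relpow_Suc_I2)
  finally show ?case .
qed

lemma (in wf_digraph) avoiding_dist_le:
  assumes "u \<in> verts G" "(u, v) \<in> arc_rel G A ^^ n" shows "avoiding_dist G A u v \<le> enat n"
proof -
  obtain p where "awalk u p v" "set p \<inter> A = {}" "length p = n"
    using awalk_iff_relpow[OF assms(1)] assms(2) by blast
  then show ?thesis
    unfolding avoiding_dist_def by (auto intro: INF_lower2)
qed

lemma (in wf_digraph) avoiding_dist_attained: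
  assumes "u \<in> verts G" "avoiding_dist G A u v = enat n" shows "(u, v) \<in> arc_rel G A ^^ n"
proof -
  let ?W = "{p. awalk u p v \<and> set p \<inter> A = {}}"
  have "?W \<noteq> {}"
  proof
    assume empty: "?W = {}"
    have "avoiding_dist G A u v = \<infinity>"
      unfolding avoiding_dist_def empty by (simp add: top_enat_def)
    then show False
      using assms(2) by simp
  qed
  then obtain p where "p \<in> ?W"
    by blast
  then have "avoiding_dist G A u v \<in> (\<lambda>p. enat (length p)) ` ?W"
    unfolding avoiding_dist_def by (rule wellorder_InfI[OF imageI])
  then show ?thesis
    using awalk_iff_relpow[OF assms(1)] assms(2) by auto
qed

context group
begin

context
  fixes X H :: "'a set"
  assumes X: "X \<subseteq> carrier G" and H: "subgroup H G"
begin

lemma letter_in_carrier: "a \<in> X <+> (H - {\<one>}) \<Longrightarrow> letter_val a \<in> carrier G"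
  using X subgroup.subset[OF H] by (auto simp: letter_val_def)

lemma wf_cayley_graph: "wf_digraph (cayley_graph G X H)"
  using X subgroup.subset[OF H]
  by unfold_locales (auto simp: cayley_graph_def letter_val_def split: if_splits)

lemma arc_rel_cayley_iff:
  "(x, y) \<in> arc_rel (cayley_graph G X H) {} \<longleftrightarrow> x \<in> carrier G \<and>
    (\<exists>a\<in>X <+> (H - {\<one>}). y = x \<otimes> letter_val a) \<or> y \<in> carrier G \<and>
    (\<exists>a\<in>X <+> (H - {\<one>}). x = y \<otimes> letter_val a)"
proof -
  have "(x, y) \<in> arc_rel (cayley_graph G X H) {} \<longleftrightarrow>
      (\<exists>g a b. g \<in> carrier G \<and> a \<in> X <+> (H - {\<one>}) \<and>
        x = (if b then g else g \<otimes> letter_val a) \<and> y = (if b then g \<otimes> letter_val a else g))"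
    by (simp add: arc_rel_def cayley_graph_def) blast
  then show ?thesis
    by (simp add: ex_bool_eq) blast
qed

lemma sym_arc_rel_cayley: "sym (arc_rel (cayley_graph G X H) {})"
  by (rule symI) (auto simp: arc_rel_cayley_iff)

lemma arc_rel_cayley_mult:
  assumes "g \<in> carrier G" "(x, y) \<in> arc_rel (cayley_graph G X H) {}"
  shows "(g \<otimes> x, g \<otimes> y) \<in> arc_rel (cayley_graph G X H) {}"
  using assms letter_in_carrier unfolding arc_rel_cayley_iff by (fastforce simp: m_assoc)

lemma arc_rel_cayley_relpow_mult:
  assumes "g \<in> carrier G" "(x, y) \<in> arc_rel (cayley_graph G X H) {} ^^ n"
  shows "(g \<otimes> x, g \<otimes> y) \<in> arc_rel (cayley_graph G X H) {} ^^ n"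
  using assms(2)
proof (induction n arbitrary: y)
  case (Suc n)
  then obtain z where "(x, z) \<in> arc_rel (cayley_graph G X H) {} ^^ n"
      "(z, y) \<in> arc_rel (cayley_graph G X H) {}"
    by (meson relpow_Suc_E)
  then show ?case
    using Suc.IH arc_rel_cayley_mult[OF assms(1)] by (blast intro: relpow_Suc_I)
qed simp

lemma arc_rel_cayley_in_carrier:
  "(x, y) \<in> arc_rel (cayley_graph G X H) {} \<Longrightarrow> x \<in> carrier G \<and> y \<in> carrier G"
  using letter_in_carrier unfolding arc_rel_cayley_iff by auto

text \<open>
  An arc with an endpoint outside \<open>H\<close> is not in the complete subgraph on \<open>H\<close>, so a path without
  edges inside \<open>H\<close> is admissible for \<^const>\<open>hat_dist\<close>.
\<close>

lemma arc_rel_off_subgroup: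
  assumes "(x, y) \<in> arc_rel (cayley_graph G X H) {}" "\<not> (x \<in> H \<and> y \<in> H)"
  shows "(x, y) \<in> arc_rel (cayley_graph G X H) (subgroup_arcs G H)"
proof -
  obtain e where e: "e \<in> arcs (cayley_graph G X H)" "tail (cayley_graph G X H) e = x"
      "head (cayley_graph G X H) e = y"
    using assms(1) by (auto simp: arc_rel_def)
  have "e \<notin> subgroup_arcs G H"
  proof
    assume "e \<in> subgroup_arcs G H"
    then obtain h k b where "e = (h, Inr k, b)" "h \<in> H" "k \<in> H"
      by (auto simp: subgroup_arcs_def)
    moreover have "h \<otimes> k \<in> H"
      using subgroup.m_closed[OF H] calculation by blast
    ultimately have "x \<in> H" "y \<in> H"
      using e(2,3) by (auto simp: cayley_graph_def letter_val_def)
    then show False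
      using assms(2) by blast
  qed
  then show ?thesis
    using e unfolding arc_rel_def by blast
qed

lemma arc_rel_cayley_subgroup:
  assumes "h \<in> H" "k \<in> H" "h \<noteq> k" shows "(h, k) \<in> arc_rel (cayley_graph G X H) {}"
proof -
  have G: "h \<in> carrier G" "k \<in> carrier G"
    using assms subgroup.subset[OF H] by auto
  have "inv h \<otimes> k \<in> H"
    using assms subgroup.m_closed[OF H] subgroup.m_inv_closed[OF H] by blast
  moreover have "h \<otimes> (inv h \<otimes> k) = k"
    using G by (simp add: m_assoc[symmetric])
  moreover have "inv h \<otimes> k \<noteq> \<one>"
    using calculation(2) G assms(3) by auto
  ultimately have "Inr (inv h \<otimes> k) \<in> X <+> (H - {\<one>})" "k = h \<otimes> letter_val (Inr (inv h \<otimes> k))"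
    by (auto simp: letter_val_def)
  then show ?thesis
    unfolding arc_rel_cayley_iff using G by blast
qed

end

end

text \<open>
  The metric is that of the Cayley graph.  A path off \<open>H\<close> from \<open>\<one>\<close> to \<open>h\<close> is at least as long as
  \<open>hat_dist G X H \<one> h\<close>, so local finiteness bounds the number of linked \<open>h\<close>.
\<close>

lemma coset_geometry_of_hyperbolically_embedded:
  fixes G :: "('g, 'b) monoid_scheme" (structure)
  assumes "group G" and emb: "hyperbolically_embedded_wrt G X H"
  shows "\<exists>d \<delta>. hyperbolic_coset_geometry G d \<delta> H"
proof -
  interpret group G by fact
  define D where "D = cayley_graph G X H"
  define E where "E = arc_rel D {}"
  define d where "d u v = the_enat (graph_dist D u v)" for u v
  have X: "X \<subseteq> carrier G" and H: "subgroup H G" and hyp: "hyperbolic_graph D"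
    and fin: "\<And>h n. h \<in> H \<Longrightarrow> finite {k \<in> H. hat_dist G X H h k \<le> enat n}"
    using emb by (auto simp: hyperbolically_embedded_wrt_def D_def)
  interpret wf_digraph D
    using wf_cayley_graph[OF X H] by (simp add: D_def)
  have verts: "verts D = carrier G"
    by (simp add: D_def cayley_graph_def)
  have conn: "graph_dist D u v = enat (d u v)" if "u \<in> carrier G" "v \<in> carrier G" for u v
  proof -
    have "graph_dist D u v \<noteq> \<infinity>"
      using hyp that unfolding hyperbolic_graph_def verts by blast
    then show ?thesis
      by (cases "graph_dist D u v") (simp_all add: d_def)
  qed
  have path: "(u, v) \<in> E ^^ d u v" if "u \<in> carrier G" "v \<in> carrier G" for u v
    using avoiding_dist_attained[OF _ conn[OF that]] that by (simp add: verts E_def)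
  have le: "d u v \<le> n" if "u \<in> carrier G" "v \<in> carrier G" "(u, v) \<in> E ^^ n" for u v n
    using avoiding_dist_le[of u v n "{}"] that by (simp add: verts E_def conn)
  have E_carrier: "x \<in> carrier G" "y \<in> carrier G" if "(x, y) \<in> E" for x y
    using arc_rel_cayley_in_carrier[OF X H] that unfolding E_def D_def by blast+
  have sym: "sym (E ^^ n)" for n
    unfolding E_def D_def by (intro relpow_sym sym_arc_rel_cayley[OF X H])
  have mult: "(g \<otimes> x, g \<otimes> y) \<in> E ^^ n" if "g \<in> carrier G" "(x, y) \<in> E ^^ n" for g x y n
    using arc_rel_cayley_relpow_mult[OF X H that(1)] that(2) by (simp add: E_def D_def)
  obtain \<delta>' where \<delta>': "\<forall>w\<in>carrier G. \<forall>x\<in>carrier G. \<forall>y\<in>carrier G. \<forall>z\<in>carrier G.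
      min (gromov_product (\<lambda>u v. real (d u v)) w x y) (gromov_product (\<lambda>u v. real (d u v)) w y z) - \<delta>'
        \<le> gromov_product (\<lambda>u v. real (d u v)) w x z"
    using hyp by (auto simp: hyperbolic_graph_def gromov_hyperbolic_def verts d_def)
  define \<delta> where "\<delta> = nat \<lceil>2 * \<delta>'\<rceil>"
  have \<delta>: "2 * \<delta>' \<le> real \<delta>"
    by (simp add: \<delta>_def) linarith
  have d_sym: "d x y = d y x" if "x \<in> carrier G" "y \<in> carrier G" for x y
    using le[OF that symD[OF sym path[OF that(2,1)]]] le[OF that(2,1) symD[OF sym path[OF that]]]
    by simp
  interpret M: hyperbolic_graph_metric "carrier G" d \<delta>
  proof
    fix x y assume xy: "x \<in> carrier G" "y \<in> carrier G"
    show "d x y = 0 \<longleftrightarrow> x = y"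
      using path[OF xy] le[OF xy, of 0] by auto
    show "d x y = d y x"
      using d_sym xy .
    show "\<exists>z\<in>carrier G. d x z = m \<and> d z y = d x y - m" if "m \<le> d x y" for m
    proof -
      have "(x, y) \<in> E ^^ (m + (d x y - m))"
        using path[OF xy] that by simp
      then obtain z where z: "(x, z) \<in> E ^^ m" "(z, y) \<in> E ^^ (d x y - m)"
        unfolding relpow_add by blast
      have "z \<in> carrier G"
        using z(1) xy(1) E_carrier(2) by (cases m) auto
      moreover have "d x y \<le> d x z + d z y"
        using le[OF xy relpow_trans[OF path path]] xy calculation by simp
      ultimately show ?thesis
        using le[OF xy(1) _ z(1)] le[OF _ xy(2) z(2)] that by force
    qed
  next
    fix x y z assume "x \<in> carrier G" "y \<in> carrier G" "z \<in> carrier G"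
    then show "d x z \<le> d x y + d y z"
      using le[OF _ _ relpow_trans[OF path path]] by simp
  next
    fix w x y z assume G: "w \<in> carrier G" "x \<in> carrier G" "y \<in> carrier G" "z \<in> carrier G"
    have "min (gromov_product (\<lambda>u v. real (d u v)) w x y) (gromov_product (\<lambda>u v. real (d u v)) w y z) - \<delta>'
        \<le> gromov_product (\<lambda>u v. real (d u v)) w x z"
      using \<delta>' G by blast
    then consider
        "gromov_product (\<lambda>u v. real (d u v)) w x y - \<delta>' \<le> gromov_product (\<lambda>u v. real (d u v)) w x z"
      | "gromov_product (\<lambda>u v. real (d u v)) w y z - \<delta>' \<le> gromov_product (\<lambda>u v. real (d u v)) w x z"
      by (auto simp: min_def split: if_splits)
    then show "d x z + d y w \<le> max (d x y + d z w) (d x w + d y z) + \<delta>"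
    proof cases
      case 1
      then have "real (d x z + d y w) \<le> real (d x y + d z w + \<delta>)"
        using \<delta> by (simp add: gromov_product_def field_simps)
      then show ?thesis
        by (simp only: of_nat_le_iff)
    next
      case 2
      then have "real (d x z + d y w) \<le> real (d x w + d y z + \<delta>)"
        using \<delta> by (simp add: gromov_product_def field_simps)
      then show ?thesis
        by (simp only: of_nat_le_iff)
    qed
  qed
  have step: "(x, y) \<in> arc_rel D (subgroup_arcs G H)" if "(x, y) \<in> M.step_off H" for x y
  proof -
    have "(x, y) \<in> E" "\<not> (x \<in> H \<and> y \<in> H)"
      using that path[of x y] by (auto simp: M.step_off_def)
    then show ?thesis
      using arc_rel_off_subgroup[OF X H] by (simp add: E_def D_def)
  qed
  have "hyperbolic_coset_geometry G d \<delta> H"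
  proof (intro hyperbolic_coset_geometry.intro hyperbolic_coset_geometry_axioms.intro)
    show "group G" "hyperbolic_graph_metric (carrier G) d \<delta>" "subgroup H G"
      using is_group M.hyperbolic_graph_metric_axioms H .
    show "d (g \<otimes> x) (g \<otimes> y) = d x y"
      if "g \<in> carrier G" "x \<in> carrier G" "y \<in> carrier G" for g x y
    proof (rule antisym)
      show "d (g \<otimes> x) (g \<otimes> y) \<le> d x y"
        using le mult path that by simp
      have "(inv g \<otimes> (g \<otimes> x), inv g \<otimes> (g \<otimes> y)) \<in> E ^^ d (g \<otimes> x) (g \<otimes> y)"
        using that by (intro mult path) auto
      then show "d x y \<le> d (g \<otimes> x) (g \<otimes> y)"
        using that by (intro le) (auto simp: m_assoc[symmetric])
    qed
    have "d h k \<le> 1" if "h \<in> H" "k \<in> H" for h k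
    proof (cases "h = k")
      case True
      then show ?thesis
        using le[of h k 0] that subgroup.subset[OF H] by auto
    next
      case False
      then have "(h, k) \<in> E ^^ 1"
        using arc_rel_cayley_subgroup[OF X H that] by (simp add: E_def D_def)
      then show ?thesis
        using le that subgroup.subset[OF H] by blast
    qed
    then show "M.clique H"
      using subgroup.subset[OF H] by (auto simp: M.clique_def)
    show "finite {h \<in> H. (\<one>, h) \<in> M.linked_off H n}" for n
    proof (rule finite_subset)
      show "finite {k \<in> H. hat_dist G X H \<one> k \<le> enat n}"
        using fin subgroup.one_closed[OF H] by blast
      show "{h \<in> H. (\<one>, h) \<in> M.linked_off H n} \<subseteq> {k \<in> H. hat_dist G X H \<one> k \<le> enat n}"
      proof safe
        fix h assume "(\<one>, h) \<in> M.linked_off H n"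
        then obtain m where m: "m \<le> n" "(\<one>, h) \<in> M.step_off H ^^ m"
          by (auto simp: M.linked_off_def)
        have "(\<one>, h) \<in> arc_rel D (subgroup_arcs G H) ^^ m"
          using m(2) step unfolding relpow_fun_conv by blast
        then have "hat_dist G X H \<one> h \<le> enat m"
          unfolding hat_dist_def D_def[symmetric] by (intro avoiding_dist_le) (simp_all add: verts)
        then show "hat_dist G X H \<one> h \<le> enat n"
          using m(1) by (meson enat_ord_simps(1) order_trans)
      qed
    qed
  qed
  then show ?thesis by blast
qed

theorem corollary1p5:
  fixes G :: "('g, 'b) monoid_scheme"
    and \<iota> :: "'f::field \<Rightarrow> complex"
    and scale :: "'f \<Rightarrow> 'v::ab_group_add \<Rightarrow> 'v"
    and nrm :: "'v \<Rightarrow> real"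
    and act :: "'g \<Rightarrow> 'v \<Rightarrow> 'v"
  assumes "group G"
    and "hyperbolically_embedded G H"
    and "normed_group_module G \<iota> scale nrm act"
    and "group_submodule scale act H U"
  shows "\<exists>\<kappa>. \<kappa> \<in> QZ1 act nrm (G\<lparr>carrier := H\<rparr>) U \<rightarrow> QZ1 act nrm G UNIV \<and>
    (\<forall>q \<in> QZ1 act nrm (G\<lparr>carrier := H\<rparr>) U. \<forall>r \<in> QZ1 act nrm (G\<lparr>carrier := H\<rparr>) U.
       \<kappa> (\<lambda>h\<in>H. q h + r h) = (\<lambda>g\<in>carrier G. \<kappa> q g + \<kappa> r g)) \<and>
    (\<forall>a. \<forall>q \<in> QZ1 act nrm (G\<lparr>carrier := H\<rparr>) U.
       \<kappa> (\<lambda>h\<in>H. scale a (q h)) = (\<lambda>g\<in>carrier G. scale a (\<kappa> q g))) \<and>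
    (\<forall>q \<in> QZ1 act nrm (G\<lparr>carrier := H\<rparr>) U.
       restrict (\<kappa> q) H \<in> QZ1 act nrm (G\<lparr>carrier := H\<rparr>) U \<and>
       bdd_above ((\<lambda>h. nrm (\<kappa> q h - q h)) ` H))"
proof -
  obtain X where "hyperbolically_embedded_wrt G X H"
    using assms(2) by (auto simp: hyperbolically_embedded_def)
  then obtain d \<delta> where geometry: "hyperbolic_coset_geometry G d \<delta> H"
    using coset_geometry_of_hyperbolically_embedded[OF assms(1)] by blast
  interpret induced_quasi_cocycle G d \<delta> H \<iota> scale nrm act
    using geometry assms(3) by (rule induced_quasi_cocycle.intro)
  show ?thesis
    by (intro exI[of _ extension] conjI ballI allI funcsetI extension_in_QZ1 extension_add
        extension_scale restrict_extension_in_QZ1 extension_near assms(4))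
qed

end
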